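(* Let $R$ and $S$ be rings and let $W$ be an $(R,S)$-bimodule. Then the adjoint category $\mathrm{Adj}(W)$ is a complete and cocomplete abelian category.
   Context: Homomorphisms of left $R$-modules are written on the right of their arguments ($u\mu$), homomorphisms of right $S$-modules on the left ($\nu v$). For a left $R$-module $U$, a right $S$-module $V$ and an $(R,S)$-bimodule $W$, an $(R,S)$-bimap is a function $B:U\times V\to W$, written $uBv$, that is additive in each variable and satisfies $(ru)Bv=r(uBv)$ and $uB(vs)=(uBv)s$ for all $r\in R$, $s\in S$, $u\in U$, $v\in V$. The adjoint category $\mathrm{Adj}(W)$ (with the $(R,S)$-bimodule $W$ fixed) has as objects all $(R,S)$-bimaps $B:U\times V\to W$ into $W$ ($U$, $V$ arbitrary). A morphism (adjoint-morphism) from $B:U\times V\to W$ to $C:U'\times V'\to W$ is a pair $(\overleftarrow{\mu},\overrightarrow{\mu})$ with $\overleftarrow{\mu}\in\mathrm{Hom}_R(U,U')$ and $\overrightarrow{\mu}\in\mathrm{Hom}_S(V',V)$ such that $(u\overleftarrow{\mu})Cv'=uB(\overrightarrow{\mu}v')$ for all $u\in U$, $v'\in V'$. The composite of $(\overleftarrow{\mu},\overrightarrow{\mu}):B\to C$ followed by $(\overleftarrow{\nu},\overrightarrow{\nu}):C\to D$ is the pair consisting of $u\mapsto (u\overleftarrow{\mu})\overleftarrow{\nu}$ and $v\mapsto \overrightarrow{\mu}(\overrightarrow{\nu}v)$. Morphisms are added componentwise. *)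

theory Defs
  imports "HOL-Algebra.Module" "HOL-Library.Equipollence"
begin

section \<open>Categories\<close>

text \<open>
  Hom-sets for different pairs of objects may overlap, so composition carries the objects:
  \<open>Comp C X Y Z f g\<close> is \<open>f : X \<rightarrow> Y\<close> followed by \<open>g : Y \<rightarrow> Z\<close>.
  All operations are meaningful only on members of \<open>Obj C\<close>.
\<close>

record ('o, 'a) category =
  Obj :: "'o set"
  Hom :: "'o \<Rightarrow> 'o \<Rightarrow> 'a set"
  Ident :: "'o \<Rightarrow> 'a"
  Comp :: "'o \<Rightarrow> 'o \<Rightarrow> 'o \<Rightarrow> 'a \<Rightarrow> 'a \<Rightarrow> 'a"

locale category =
  fixes C :: "('o, 'a, 'z) category_scheme"
  assumes Ident_in_Hom: "X \<in> Obj C \<Longrightarrow> Ident C X \<in> Hom C X X"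
    and Comp_in_Hom:
      "\<lbrakk>X \<in> Obj C; Y \<in> Obj C; Z \<in> Obj C; f \<in> Hom C X Y; g \<in> Hom C Y Z\<rbrakk>
        \<Longrightarrow> Comp C X Y Z f g \<in> Hom C X Z"
    and Ident_left:
      "\<lbrakk>X \<in> Obj C; Y \<in> Obj C; f \<in> Hom C X Y\<rbrakk> \<Longrightarrow> Comp C X X Y (Ident C X) f = f"
    and Ident_right:
      "\<lbrakk>X \<in> Obj C; Y \<in> Obj C; f \<in> Hom C X Y\<rbrakk> \<Longrightarrow> Comp C X Y Y f (Ident C Y) = f"
    and Comp_assoc:
      "\<lbrakk>X \<in> Obj C; Y \<in> Obj C; Z \<in> Obj C; T \<in> Obj C;
        f \<in> Hom C X Y; g \<in> Hom C Y Z; h \<in> Hom C Z T\<rbrakk>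
        \<Longrightarrow> Comp C X Z T (Comp C X Y Z f g) h = Comp C X Y T f (Comp C Y Z T g h)"

definition is_mono :: "('o, 'a, 'z) category_scheme \<Rightarrow> 'o \<Rightarrow> 'o \<Rightarrow> 'a \<Rightarrow> bool" where
  "is_mono C X Y f \<longleftrightarrow> f \<in> Hom C X Y \<and>
    (\<forall>Z \<in> Obj C. \<forall>g \<in> Hom C Z X. \<forall>h \<in> Hom C Z X.
      Comp C Z X Y g f = Comp C Z X Y h f \<longrightarrow> g = h)"

definition is_epi :: "('o, 'a, 'z) category_scheme \<Rightarrow> 'o \<Rightarrow> 'o \<Rightarrow> 'a \<Rightarrow> bool" where
  "is_epi C X Y f \<longleftrightarrow> f \<in> Hom C X Y \<and>
    (\<forall>Z \<in> Obj C. \<forall>g \<in> Hom C Y Z. \<forall>h \<in> Hom C Y Z.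
      Comp C X Y Z f g = Comp C X Y Z f h \<longrightarrow> g = h)"

subsection \<open>Limits and colimits\<close>

definition is_functor ::
  "('i, 'j, 'y) category_scheme \<Rightarrow> ('o, 'a, 'z) category_scheme
    \<Rightarrow> ('i \<Rightarrow> 'o) \<Rightarrow> ('i \<Rightarrow> 'i \<Rightarrow> 'j \<Rightarrow> 'a) \<Rightarrow> bool" where
  "is_functor J C F\<^sub>0 F\<^sub>1 \<longleftrightarrow>
    (\<forall>i \<in> Obj J. F\<^sub>0 i \<in> Obj C) \<and>
    (\<forall>i \<in> Obj J. \<forall>j \<in> Obj J. \<forall>f \<in> Hom J i j. F\<^sub>1 i j f \<in> Hom C (F\<^sub>0 i) (F\<^sub>0 j)) \<and>
    (\<forall>i \<in> Obj J. F\<^sub>1 i i (Ident J i) = Ident C (F\<^sub>0 i)) \<and>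
    (\<forall>i \<in> Obj J. \<forall>j \<in> Obj J. \<forall>k \<in> Obj J. \<forall>f \<in> Hom J i j. \<forall>g \<in> Hom J j k.
      F\<^sub>1 i k (Comp J i j k f g) = Comp C (F\<^sub>0 i) (F\<^sub>0 j) (F\<^sub>0 k) (F\<^sub>1 i j f) (F\<^sub>1 j k g))"

definition is_cone ::
  "('i, 'j, 'y) category_scheme \<Rightarrow> ('o, 'a, 'z) category_scheme
    \<Rightarrow> ('i \<Rightarrow> 'o) \<Rightarrow> ('i \<Rightarrow> 'i \<Rightarrow> 'j \<Rightarrow> 'a) \<Rightarrow> 'o \<Rightarrow> ('i \<Rightarrow> 'a) \<Rightarrow> bool" where
  "is_cone J C F\<^sub>0 F\<^sub>1 X \<pi> \<longleftrightarrow> X \<in> Obj C \<and>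
    (\<forall>i \<in> Obj J. \<pi> i \<in> Hom C X (F\<^sub>0 i)) \<and>
    (\<forall>i \<in> Obj J. \<forall>j \<in> Obj J. \<forall>f \<in> Hom J i j.
      Comp C X (F\<^sub>0 i) (F\<^sub>0 j) (\<pi> i) (F\<^sub>1 i j f) = \<pi> j)"

definition is_limit ::
  "('i, 'j, 'y) category_scheme \<Rightarrow> ('o, 'a, 'z) category_scheme
    \<Rightarrow> ('i \<Rightarrow> 'o) \<Rightarrow> ('i \<Rightarrow> 'i \<Rightarrow> 'j \<Rightarrow> 'a) \<Rightarrow> 'o \<Rightarrow> ('i \<Rightarrow> 'a) \<Rightarrow> bool" where
  "is_limit J C F\<^sub>0 F\<^sub>1 X \<pi> \<longleftrightarrow> is_cone J C F\<^sub>0 F\<^sub>1 X \<pi> \<and>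
    (\<forall>Y \<rho>. is_cone J C F\<^sub>0 F\<^sub>1 Y \<rho> \<longrightarrow>
      (\<exists>!h. h \<in> Hom C Y X \<and> (\<forall>i \<in> Obj J. Comp C Y X (F\<^sub>0 i) h (\<pi> i) = \<rho> i)))"

definition is_cocone ::
  "('i, 'j, 'y) category_scheme \<Rightarrow> ('o, 'a, 'z) category_scheme
    \<Rightarrow> ('i \<Rightarrow> 'o) \<Rightarrow> ('i \<Rightarrow> 'i \<Rightarrow> 'j \<Rightarrow> 'a) \<Rightarrow> 'o \<Rightarrow> ('i \<Rightarrow> 'a) \<Rightarrow> bool" where
  "is_cocone J C F\<^sub>0 F\<^sub>1 X \<iota> \<longleftrightarrow> X \<in> Obj C \<and>
    (\<forall>i \<in> Obj J. \<iota> i \<in> Hom C (F\<^sub>0 i) X) \<and>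
    (\<forall>i \<in> Obj J. \<forall>j \<in> Obj J. \<forall>f \<in> Hom J i j.
      Comp C (F\<^sub>0 i) (F\<^sub>0 j) X (F\<^sub>1 i j f) (\<iota> j) = \<iota> i)"

definition is_colimit ::
  "('i, 'j, 'y) category_scheme \<Rightarrow> ('o, 'a, 'z) category_scheme
    \<Rightarrow> ('i \<Rightarrow> 'o) \<Rightarrow> ('i \<Rightarrow> 'i \<Rightarrow> 'j \<Rightarrow> 'a) \<Rightarrow> 'o \<Rightarrow> ('i \<Rightarrow> 'a) \<Rightarrow> bool" where
  "is_colimit J C F\<^sub>0 F\<^sub>1 X \<iota> \<longleftrightarrow> is_cocone J C F\<^sub>0 F\<^sub>1 X \<iota> \<and>
    (\<forall>Y \<rho>. is_cocone J C F\<^sub>0 F\<^sub>1 Y \<rho> \<longrightarrow>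
      (\<exists>!h. h \<in> Hom C X Y \<and> (\<forall>i \<in> Obj J. Comp C (F\<^sub>0 i) X Y (\<iota> i) h = \<rho> i)))"

text \<open>Completeness is relative to a notion \<open>small\<close> of small index category.\<close>

definition complete_category ::
  "(('i, 'j) category \<Rightarrow> bool) \<Rightarrow> ('o, 'a, 'z) category_scheme \<Rightarrow> bool" where
  "complete_category small C \<longleftrightarrow>
    (\<forall>J F\<^sub>0 F\<^sub>1. category J \<and> small J \<and> is_functor J C F\<^sub>0 F\<^sub>1
      \<longrightarrow> (\<exists>X \<pi>. is_limit J C F\<^sub>0 F\<^sub>1 X \<pi>))"

definition cocomplete_category ::
  "(('i, 'j) category \<Rightarrow> bool) \<Rightarrow> ('o, 'a, 'z) category_scheme \<Rightarrow> bool" where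
  "cocomplete_category small C \<longleftrightarrow>
    (\<forall>J F\<^sub>0 F\<^sub>1. category J \<and> small J \<and> is_functor J C F\<^sub>0 F\<^sub>1
      \<longrightarrow> (\<exists>X \<iota>. is_colimit J C F\<^sub>0 F\<^sub>1 X \<iota>))"

subsection \<open>Abelian categories\<close>

record ('o, 'a) preadditive_category = "('o, 'a) category" +
  HAdd :: "'o \<Rightarrow> 'o \<Rightarrow> 'a \<Rightarrow> 'a \<Rightarrow> 'a"
  HZero :: "'o \<Rightarrow> 'o \<Rightarrow> 'a"

definition hom_group ::
  "('o, 'a, 'z) preadditive_category_scheme \<Rightarrow> 'o \<Rightarrow> 'o \<Rightarrow> 'a monoid" where
  "hom_group C X Y = \<lparr>carrier = Hom C X Y, mult = HAdd C X Y, one = HZero C X Y\<rparr>"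

locale preadditive_category = category C
  for C :: "('o, 'a, 'z) preadditive_category_scheme" +
  assumes hom_comm_group:
      "\<lbrakk>X \<in> Obj C; Y \<in> Obj C\<rbrakk> \<Longrightarrow> comm_group (hom_group C X Y)"
    and Comp_HAdd_left:
      "\<lbrakk>X \<in> Obj C; Y \<in> Obj C; Z \<in> Obj C; f \<in> Hom C X Y; f' \<in> Hom C X Y; g \<in> Hom C Y Z\<rbrakk>
        \<Longrightarrow> Comp C X Y Z (HAdd C X Y f f') g
            = HAdd C X Z (Comp C X Y Z f g) (Comp C X Y Z f' g)"
    and Comp_HAdd_right:
      "\<lbrakk>X \<in> Obj C; Y \<in> Obj C; Z \<in> Obj C; f \<in> Hom C X Y; g \<in> Hom C Y Z; g' \<in> Hom C Y Z\<rbrakk>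
        \<Longrightarrow> Comp C X Y Z f (HAdd C Y Z g g')
            = HAdd C X Z (Comp C X Y Z f g) (Comp C X Y Z f g')"

definition is_zero_object :: "('o, 'a, 'z) category_scheme \<Rightarrow> 'o \<Rightarrow> bool" where
  "is_zero_object C Z \<longleftrightarrow> Z \<in> Obj C \<and>
    (\<forall>X \<in> Obj C. (\<exists>!f. f \<in> Hom C X Z) \<and> (\<exists>!f. f \<in> Hom C Z X))"

definition is_biproduct ::
  "('o, 'a, 'z) preadditive_category_scheme \<Rightarrow> 'o \<Rightarrow> 'o \<Rightarrow> 'o
    \<Rightarrow> 'a \<Rightarrow> 'a \<Rightarrow> 'a \<Rightarrow> 'a \<Rightarrow> bool" where
  "is_biproduct C X Y P \<iota>\<^sub>1 \<iota>\<^sub>2 \<pi>\<^sub>1 \<pi>\<^sub>2 \<longleftrightarrow> P \<in> Obj C \<and>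
    \<iota>\<^sub>1 \<in> Hom C X P \<and> \<iota>\<^sub>2 \<in> Hom C Y P \<and> \<pi>\<^sub>1 \<in> Hom C P X \<and> \<pi>\<^sub>2 \<in> Hom C P Y \<and>
    Comp C X P X \<iota>\<^sub>1 \<pi>\<^sub>1 = Ident C X \<and> Comp C Y P Y \<iota>\<^sub>2 \<pi>\<^sub>2 = Ident C Y \<and>
    HAdd C P P (Comp C P X P \<pi>\<^sub>1 \<iota>\<^sub>1) (Comp C P Y P \<pi>\<^sub>2 \<iota>\<^sub>2) = Ident C P"

definition is_kernel ::
  "('o, 'a, 'z) preadditive_category_scheme \<Rightarrow> 'o \<Rightarrow> 'o \<Rightarrow> 'a \<Rightarrow> 'o \<Rightarrow> 'a \<Rightarrow> bool" where
  "is_kernel C X Y f K k \<longleftrightarrow> K \<in> Obj C \<and> k \<in> Hom C K X \<and>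
    Comp C K X Y k f = HZero C K Y \<and>
    (\<forall>Z \<in> Obj C. \<forall>g \<in> Hom C Z X. Comp C Z X Y g f = HZero C Z Y \<longrightarrow>
      (\<exists>!h. h \<in> Hom C Z K \<and> Comp C Z K X h k = g))"

definition is_cokernel ::
  "('o, 'a, 'z) preadditive_category_scheme \<Rightarrow> 'o \<Rightarrow> 'o \<Rightarrow> 'a \<Rightarrow> 'o \<Rightarrow> 'a \<Rightarrow> bool" where
  "is_cokernel C X Y f Q q \<longleftrightarrow> Q \<in> Obj C \<and> q \<in> Hom C Y Q \<and>
    Comp C X Y Q f q = HZero C X Q \<and>
    (\<forall>Z \<in> Obj C. \<forall>g \<in> Hom C Y Z. Comp C X Y Z f g = HZero C X Z \<longrightarrow>
      (\<exists>!h. h \<in> Hom C Q Z \<and> Comp C Y Q Z q h = g))"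

locale abelian_category = preadditive_category C
  for C :: "('o, 'a, 'z) preadditive_category_scheme" +
  assumes zero_object: "\<exists>Z. is_zero_object C Z"
    and biproducts:
      "\<lbrakk>X \<in> Obj C; Y \<in> Obj C\<rbrakk> \<Longrightarrow> \<exists>P \<iota>\<^sub>1 \<iota>\<^sub>2 \<pi>\<^sub>1 \<pi>\<^sub>2. is_biproduct C X Y P \<iota>\<^sub>1 \<iota>\<^sub>2 \<pi>\<^sub>1 \<pi>\<^sub>2"
    and kernels:
      "\<lbrakk>X \<in> Obj C; Y \<in> Obj C; f \<in> Hom C X Y\<rbrakk> \<Longrightarrow> \<exists>K k. is_kernel C X Y f K k"
    and cokernels:
      "\<lbrakk>X \<in> Obj C; Y \<in> Obj C; f \<in> Hom C X Y\<rbrakk> \<Longrightarrow> \<exists>Q q. is_cokernel C X Y f Q q"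
    and mono_is_kernel:
      "\<lbrakk>X \<in> Obj C; Y \<in> Obj C; is_mono C X Y f\<rbrakk>
        \<Longrightarrow> \<exists>Z \<in> Obj C. \<exists>g \<in> Hom C Y Z. is_kernel C Y Z g X f"
    and epi_is_cokernel:
      "\<lbrakk>X \<in> Obj C; Y \<in> Obj C; is_epi C X Y f\<rbrakk>
        \<Longrightarrow> \<exists>Z \<in> Obj C. \<exists>g \<in> Hom C Z X. is_cokernel C Z X g Y f"

section \<open>Set universes and smallness\<close>

text \<open>
  Since a HOL type is not closed under all set-theoretic constructions, ``all modules'' and
  ``small'' are relative to a universe \<open>\<U>\<close> of sets over a type.  A universe is only required
  to be closed under subsets and binary products, and an index set is small if \<open>\<U>\<close> is closed
  under products of families over it; both up to bijection.  For a Grothendieck universe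
  all members are small in this sense.  By the lemmas at the end of this section, if \<open>'k\<close> is infinite
  then all sets over \<open>'k set\<close> form a universe for which every index set not larger than \<open>'k\<close>
  is small.
\<close>

definition set_universe :: "'m set set \<Rightarrow> bool" where
  "set_universe \<U> \<longleftrightarrow> (\<exists>A \<in> \<U>. A \<noteq> {}) \<and> (\<forall>A \<in> \<U>. \<forall>B. B \<subseteq> A \<longrightarrow> B \<in> \<U>) \<and>
    (\<forall>A \<in> \<U>. \<forall>B \<in> \<U>. \<exists>P \<in> \<U>. P \<approx> A \<times> B)"

definition small_index :: "'m set set \<Rightarrow> 'i set \<Rightarrow> bool" where
  "small_index \<U> I \<longleftrightarrow> (\<forall>A. (\<forall>i \<in> I. A i \<in> \<U>) \<longrightarrow> (\<exists>P \<in> \<U>. P \<approx> (\<Pi>\<^sub>E i \<in> I. A i)))"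

definition small_category :: "'m set set \<Rightarrow> ('i, 'j) category \<Rightarrow> bool" where
  "small_category \<U> J \<longleftrightarrow> small_index \<U> (Obj J) \<and>
    small_index \<U> {(i, j, f). i \<in> Obj J \<and> j \<in> Obj J \<and> f \<in> Hom J i j}"

lemma small_index_UNIV:
  fixes I :: "'i set"
  assumes inf: "infinite (UNIV :: 'k set)" and I: "I \<lesssim> (UNIV :: 'k set)"
  shows "small_index (UNIV :: 'k set set set) I"
  unfolding small_index_def
proof (intro allI impI)
  fix A :: "'i \<Rightarrow> 'k set set"
  have "I \<times> (UNIV :: 'k set) \<lesssim> (UNIV :: 'k set) \<times> (UNIV :: 'k set)"
    by (rule times_lepoll_mono[OF I lepoll_refl])
  also have "\<dots> \<approx> (UNIV :: 'k set)"
    using card_of_Times_same_infinite[OF inf] by (simp add: eqpoll_iff_card_of_ordIso)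
  finally obtain c :: "'i \<times> 'k \<Rightarrow> 'k" where c: "inj_on c (I \<times> UNIV)"
    by (auto simp: lepoll_def)
  define e where "e g = c ` {(i, x). i \<in> I \<and> x \<in> g i}" for g :: "'i \<Rightarrow> 'k set"
  have "inj_on e (\<Pi>\<^sub>E i \<in> I. A i)"
  proof (rule inj_onI)
    fix g h assume g: "g \<in> (\<Pi>\<^sub>E i \<in> I. A i)" and h: "h \<in> (\<Pi>\<^sub>E i \<in> I. A i)" and eq: "e g = e h"
    have "{(i, x). i \<in> I \<and> x \<in> g i} = {(i, x). i \<in> I \<and> x \<in> h i}"
      by (rule inj_on_image_eq_iff[OF c, THEN iffD1]) (use eq in \<open>auto simp: e_def\<close>)
    then have "g i = h i" if "i \<in> I" for i
      using that by (auto simp: set_eq_iff)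
    then show "g = h"
      using g h by (intro PiE_ext)
  qed
  then have "e ` (\<Pi>\<^sub>E i \<in> I. A i) \<approx> (\<Pi>\<^sub>E i \<in> I. A i)"
    by (rule inj_on_image_eqpoll_self)
  then show "\<exists>P \<in> (UNIV :: 'k set set set). P \<approx> (\<Pi>\<^sub>E i \<in> I. A i)"
    by (rule bexI) (rule UNIV_I)
qed

lemma set_universe_UNIV:
  assumes inf: "infinite (UNIV :: 'm set)"
  shows "set_universe (UNIV :: 'm set set)"
proof -
  have "\<exists>P :: 'm set. P \<approx> A \<times> B" for A B :: "'m set"
  proof -
    have "A \<times> B \<lesssim> (UNIV :: 'm set) \<times> (UNIV :: 'm set)"
      by (intro subset_imp_lepoll) auto
    also have "\<dots> \<approx> (UNIV :: 'm set)"
      using card_of_Times_same_infinite[OF inf] by (simp add: eqpoll_iff_card_of_ordIso)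
    finally obtain c :: "'m \<times> 'm \<Rightarrow> 'm" where "inj_on c (A \<times> B)"
      by (auto simp: lepoll_def)
    then have "c ` (A \<times> B) \<approx> A \<times> B"
      by (rule inj_on_image_eqpoll_self)
    then show ?thesis ..
  qed
  then show ?thesis
    unfolding set_universe_def by auto
qed

section \<open>Modules and bimodules over non-commutative rings\<close>

text \<open>
  As in \<^theory>\<open>HOL-Algebra.Module\<close>, the fields \<open>mult\<close> and \<open>one\<close> which module
  records inherit from rings play no role.
\<close>

locale left_module = R?: ring R + M?: abelian_group M
  for R :: "('r, 'p) ring_scheme" (structure) and M :: "('r, 'm, 'z) module_scheme" (structure) +
  assumes smult_closed:
      "\<lbrakk>r \<in> carrier R; x \<in> carrier M\<rbrakk> \<Longrightarrow> r \<odot>\<^bsub>M\<^esub> x \<in> carrier M"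
    and smult_l_distr:
      "\<lbrakk>r \<in> carrier R; r' \<in> carrier R; x \<in> carrier M\<rbrakk>
        \<Longrightarrow> (r \<oplus>\<^bsub>R\<^esub> r') \<odot>\<^bsub>M\<^esub> x = r \<odot>\<^bsub>M\<^esub> x \<oplus>\<^bsub>M\<^esub> r' \<odot>\<^bsub>M\<^esub> x"
    and smult_r_distr:
      "\<lbrakk>r \<in> carrier R; x \<in> carrier M; y \<in> carrier M\<rbrakk>
        \<Longrightarrow> r \<odot>\<^bsub>M\<^esub> (x \<oplus>\<^bsub>M\<^esub> y) = r \<odot>\<^bsub>M\<^esub> x \<oplus>\<^bsub>M\<^esub> r \<odot>\<^bsub>M\<^esub> y"
    and smult_assoc:
      "\<lbrakk>r \<in> carrier R; r' \<in> carrier R; x \<in> carrier M\<rbrakk>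
        \<Longrightarrow> (r \<otimes>\<^bsub>R\<^esub> r') \<odot>\<^bsub>M\<^esub> x = r \<odot>\<^bsub>M\<^esub> (r' \<odot>\<^bsub>M\<^esub> x)"
    and smult_one: "x \<in> carrier M \<Longrightarrow> \<one>\<^bsub>R\<^esub> \<odot>\<^bsub>M\<^esub> x = x"

record ('s, 'm) right_module = "'m ring" +
  ract :: "'m \<Rightarrow> 's \<Rightarrow> 'm" (infixl "\<triangleleft>\<index>" 70)

locale right_module = S?: ring S + M?: abelian_group M
  for S :: "('s, 'q) ring_scheme" (structure)
    and M :: "('s, 'm, 'z) right_module_scheme" (structure) +
  assumes ract_closed:
      "\<lbrakk>x \<in> carrier M; s \<in> carrier S\<rbrakk> \<Longrightarrow> x \<triangleleft>\<^bsub>M\<^esub> s \<in> carrier M"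
    and ract_l_distr:
      "\<lbrakk>x \<in> carrier M; y \<in> carrier M; s \<in> carrier S\<rbrakk>
        \<Longrightarrow> (x \<oplus>\<^bsub>M\<^esub> y) \<triangleleft>\<^bsub>M\<^esub> s = x \<triangleleft>\<^bsub>M\<^esub> s \<oplus>\<^bsub>M\<^esub> y \<triangleleft>\<^bsub>M\<^esub> s"
    and ract_r_distr:
      "\<lbrakk>x \<in> carrier M; s \<in> carrier S; s' \<in> carrier S\<rbrakk>
        \<Longrightarrow> x \<triangleleft>\<^bsub>M\<^esub> (s \<oplus>\<^bsub>S\<^esub> s') = x \<triangleleft>\<^bsub>M\<^esub> s \<oplus>\<^bsub>M\<^esub> x \<triangleleft>\<^bsub>M\<^esub> s'"
    and ract_assoc:
      "\<lbrakk>x \<in> carrier M; s \<in> carrier S; s' \<in> carrier S\<rbrakk>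
        \<Longrightarrow> x \<triangleleft>\<^bsub>M\<^esub> (s \<otimes>\<^bsub>S\<^esub> s') = (x \<triangleleft>\<^bsub>M\<^esub> s) \<triangleleft>\<^bsub>M\<^esub> s'"
    and ract_one: "x \<in> carrier M \<Longrightarrow> x \<triangleleft>\<^bsub>M\<^esub> \<one>\<^bsub>S\<^esub> = x"

record ('r, 's, 'w) bimodule = "('r, 'w) module" +
  bract :: "'w \<Rightarrow> 's \<Rightarrow> 'w"

definition right_part :: "('r, 's, 'w) bimodule \<Rightarrow> ('s, 'w) right_module" where
  "right_part W = \<lparr>carrier = carrier W, mult = mult W, one = one W, zero = zero W,
    add = add W, ract = bract W\<rparr>"

definition is_bimodule ::
  "('r, 'p) ring_scheme \<Rightarrow> ('s, 'q) ring_scheme \<Rightarrow> ('r, 's, 'w) bimodule \<Rightarrow> bool" where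
  "is_bimodule R S W \<longleftrightarrow> left_module R W \<and> right_module S (right_part W) \<and>
    (\<forall>r \<in> carrier R. \<forall>s \<in> carrier S. \<forall>w \<in> carrier W.
      bract W (r \<odot>\<^bsub>W\<^esub> w) s = r \<odot>\<^bsub>W\<^esub> (bract W w s))"

text \<open>Homomorphisms are extensional functions, so that equality of morphisms is HOL equality.\<close>

definition left_hom ::
  "('r, 'p) ring_scheme \<Rightarrow> ('r, 'm) module \<Rightarrow> ('r, 'm) module \<Rightarrow> ('m \<Rightarrow> 'm) set" where
  "left_hom R M N = {f \<in> carrier M \<rightarrow>\<^sub>E carrier N.
    (\<forall>x \<in> carrier M. \<forall>y \<in> carrier M. f (x \<oplus>\<^bsub>M\<^esub> y) = f x \<oplus>\<^bsub>N\<^esub> f y) \<and>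
    (\<forall>r \<in> carrier R. \<forall>x \<in> carrier M. f (r \<odot>\<^bsub>M\<^esub> x) = r \<odot>\<^bsub>N\<^esub> f x)}"

definition right_hom ::
  "('s, 'q) ring_scheme \<Rightarrow> ('s, 'm) right_module \<Rightarrow> ('s, 'm) right_module \<Rightarrow> ('m \<Rightarrow> 'm) set" where
  "right_hom S M N = {f \<in> carrier M \<rightarrow>\<^sub>E carrier N.
    (\<forall>x \<in> carrier M. \<forall>y \<in> carrier M. f (x \<oplus>\<^bsub>M\<^esub> y) = f x \<oplus>\<^bsub>N\<^esub> f y) \<and>
    (\<forall>s \<in> carrier S. \<forall>x \<in> carrier M. f (x \<triangleleft>\<^bsub>M\<^esub> s) = f x \<triangleleft>\<^bsub>N\<^esub> s)}"

section \<open>Bimaps and the adjoint category\<close>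

record ('r, 's, 'm, 'w) bimap =
  LMod :: "('r, 'm) module"
  RMod :: "('s, 'm) right_module"
  bmap :: "'m \<Rightarrow> 'm \<Rightarrow> 'w"

definition is_bimap ::
  "('r, 'p) ring_scheme \<Rightarrow> ('s, 'q) ring_scheme \<Rightarrow> ('r, 's, 'w) bimodule
    \<Rightarrow> ('r, 's, 'm, 'w) bimap \<Rightarrow> bool" where
  "is_bimap R S W B \<longleftrightarrow> (let U = LMod B; V = RMod B; b = bmap B in
    left_module R U \<and> right_module S V \<and>
    (\<forall>u \<in> carrier U. \<forall>v \<in> carrier V. b u v \<in> carrier W) \<and>
    (\<forall>u \<in> carrier U. \<forall>u' \<in> carrier U. \<forall>v \<in> carrier V.
      b (u \<oplus>\<^bsub>U\<^esub> u') v = b u v \<oplus>\<^bsub>W\<^esub> b u' v) \<and>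
    (\<forall>u \<in> carrier U. \<forall>v \<in> carrier V. \<forall>v' \<in> carrier V.
      b u (v \<oplus>\<^bsub>V\<^esub> v') = b u v \<oplus>\<^bsub>W\<^esub> b u v') \<and>
    (\<forall>r \<in> carrier R. \<forall>u \<in> carrier U. \<forall>v \<in> carrier V.
      b (r \<odot>\<^bsub>U\<^esub> u) v = r \<odot>\<^bsub>W\<^esub> b u v) \<and>
    (\<forall>s \<in> carrier S. \<forall>u \<in> carrier U. \<forall>v \<in> carrier V.
      b u (v \<triangleleft>\<^bsub>V\<^esub> s) = bract W (b u v) s))"

definition adjoint_morphisms ::
  "('r, 'p) ring_scheme \<Rightarrow> ('s, 'q) ring_scheme
    \<Rightarrow> ('r, 's, 'm, 'w) bimap \<Rightarrow> ('r, 's, 'm, 'w) bimap \<Rightarrow> (('m \<Rightarrow> 'm) \<times> ('m \<Rightarrow> 'm)) set" where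
  "adjoint_morphisms R S B C = {(\<mu>, \<nu>).
    \<mu> \<in> left_hom R (LMod B) (LMod C) \<and> \<nu> \<in> right_hom S (RMod C) (RMod B) \<and>
    (\<forall>u \<in> carrier (LMod B). \<forall>v' \<in> carrier (RMod C). bmap C (\<mu> u) v' = bmap B u (\<nu> v'))}"

definition Adj ::
  "'m set set \<Rightarrow> ('r, 'p) ring_scheme \<Rightarrow> ('s, 'q) ring_scheme \<Rightarrow> ('r, 's, 'w) bimodule
    \<Rightarrow> (('r, 's, 'm, 'w) bimap, ('m \<Rightarrow> 'm) \<times> ('m \<Rightarrow> 'm)) preadditive_category" where
  "Adj \<U> R S W = \<lparr>
    Obj = {B. is_bimap R S W B \<and> carrier (LMod B) \<in> \<U> \<and> carrier (RMod B) \<in> \<U>},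
    Hom = adjoint_morphisms R S,
    Ident = (\<lambda>B. (\<lambda>u \<in> carrier (LMod B). u, \<lambda>v \<in> carrier (RMod B). v)),
    Comp = (\<lambda>B C D (\<mu>, \<mu>') (\<nu>, \<nu>').
      (\<lambda>u \<in> carrier (LMod B). \<nu> (\<mu> u), \<lambda>v \<in> carrier (RMod D). \<mu>' (\<nu>' v))),
    HAdd = (\<lambda>B C (\<mu>, \<mu>') (\<nu>, \<nu>').
      (\<lambda>u \<in> carrier (LMod B). \<mu> u \<oplus>\<^bsub>LMod C\<^esub> \<nu> u,
       \<lambda>v \<in> carrier (RMod C). \<mu>' v \<oplus>\<^bsub>RMod B\<^esub> \<nu>' v)),
    HZero = (\<lambda>B C. (\<lambda>u \<in> carrier (LMod B). \<zero>\<^bsub>LMod C\<^esub>, \<lambda>v \<in> carrier (RMod C). \<zero>\<^bsub>RMod B\<^esub>))\<rparr>"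

end

theory Submission
  imports Defs
begin

text \<open>
  A bimap \<open>U \<times> V \<rightarrow> W\<close> is the same as an \<open>R\<close>-linear map \<open>U \<rightarrow> Hom\<^sub>S(V, W)\<close>, and an
  adjoint-morphism is a commuting square of such maps.  So the adjoint category is the comma category
  of the identity of the left \<open>R\<close>-modules over the functor \<open>Hom\<^sub>S(-, W)\<close>, which sends colimits of
  right \<open>S\<close>-modules to limits.  This is why limits exist in it and are computed by taking limits of
  the left modules and colimits of the right modules, and why kernels and cokernels behave as
  those of modules do.

  Two devices reduce the work.  A right \<open>S\<close>-module is a left module over the opposite ring of \<open>S\<close>;
  with this reading a bimap is simply a function linear in each variable, and exchanging the two sides
  is a contravariant isomorphism onto the adjoint category of the opposite bimodule
  (\<open>Adj_contravariant_iso\<close>).  Of every two dual statements, such as the existence of limits and of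
  colimits, one thus follows from the other.  Secondly, limits are built from
  products and from equalizers of whole families of parallel pairs
  (\<open>limit_if_product_and_joint_equalizer\<close>); kernels, zero objects and biproducts are special cases
  of these.

  The product of bimaps \<open>B\<^sub>i\<close> pairs the product of the left modules with the direct sum of the right
  modules, by the finite sum of the values of the \<open>B\<^sub>i\<close> (\<open>product_exists\<close>).  The equalizer of pairs
  \<open>f, g\<close> out of \<open>X\<close> consists of the left submodule on which each pair agrees and of the right
  quotient by the differences of the values of each pair; by adjointness the bimap of \<open>X\<close> vanishes
  between the elements of the former and these differences (\<open>joint_equalizer\<close>).  Smallness puts the product
  into the universe, and quotients live on sets of representatives, hence on subsets.

  In particular the kernel of \<open>f\<close> has the components \<open>ker f\<close> and \<open>coker f\<close> of the two sides.  It vanishes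
  for a monomorphism, so the left component of a monomorphism is injective and the right one is
  surjective (\<open>mono_components\<close>).  Dually an epimorphism has a surjective left and an injective
  right component, and such a pair is the cokernel of its kernel (\<open>surj_inj_is_cokernel\<close>).
\<close>

section \<open>Limits from products and joint equalizers\<close>

definition is_product ::
  "('o, 'a, 'z) category_scheme \<Rightarrow> 'i set \<Rightarrow> ('i \<Rightarrow> 'o) \<Rightarrow> 'o \<Rightarrow> ('i \<Rightarrow> 'a) \<Rightarrow> bool" where
  "is_product C I X P \<pi> \<longleftrightarrow> P \<in> Obj C \<and> (\<forall>i \<in> I. \<pi> i \<in> Hom C P (X i)) \<and>
    (\<forall>Y \<in> Obj C. \<forall>\<rho>. (\<forall>i \<in> I. \<rho> i \<in> Hom C Y (X i)) \<longrightarrow>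
      (\<exists>!h. h \<in> Hom C Y P \<and> (\<forall>i \<in> I. Comp C Y P (X i) h (\<pi> i) = \<rho> i)))"

text \<open>
  An element \<open>(Y, f, g)\<close> of \<open>E\<close> is a parallel pair \<open>f, g : X \<rightarrow> Y\<close>; all pairs are to be
  equalized at once, so that no product of the objects \<open>Y\<close> is needed.
\<close>

definition is_joint_equalizer ::
  "('o, 'a, 'z) category_scheme \<Rightarrow> 'o \<Rightarrow> ('o \<times> 'a \<times> 'a) set \<Rightarrow> 'o \<Rightarrow> 'a \<Rightarrow> bool" where
  "is_joint_equalizer C X E K k \<longleftrightarrow> K \<in> Obj C \<and> k \<in> Hom C K X \<and>
    (\<forall>(Y, f, g) \<in> E. Comp C K X Y k f = Comp C K X Y k g) \<and>
    (\<forall>Z \<in> Obj C. \<forall>t \<in> Hom C Z X.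
      (\<forall>(Y, f, g) \<in> E. Comp C Z X Y t f = Comp C Z X Y t g) \<longrightarrow>
      (\<exists>!h. h \<in> Hom C Z K \<and> Comp C Z K X h k = t))"

text \<open>
  A morphism into the product \<open>P\<close> is a family of morphisms to the \<open>F\<^sub>0 i\<close>, and it is a cone exactly
  if it equalizes \<open>\<pi>\<^sub>i \<cdot> F\<^sub>1 f\<close> and \<open>\<pi>\<^sub>j\<close> for every arrow \<open>f : i \<rightarrow> j\<close>.
\<close>

lemma (in category) limit_if_product_and_joint_equalizer:
  assumes F: "is_functor J C F\<^sub>0 F\<^sub>1"
    and P: "is_product C (Obj J) F\<^sub>0 P \<pi>"
    and K: "is_joint_equalizer C P
      {(F\<^sub>0 j, Comp C P (F\<^sub>0 i) (F\<^sub>0 j) (\<pi> i) (F\<^sub>1 i j f), \<pi> j) |i j f.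
        i \<in> Obj J \<and> j \<in> Obj J \<and> f \<in> Hom J i j} K k"
  shows "is_limit J C F\<^sub>0 F\<^sub>1 K (\<lambda>i. Comp C K P (F\<^sub>0 i) k (\<pi> i))"
proof -
  have F0: "F\<^sub>0 i \<in> Obj C" if "i \<in> Obj J" for i
    using F that by (auto simp: is_functor_def)
  have F1: "F\<^sub>1 i j f \<in> Hom C (F\<^sub>0 i) (F\<^sub>0 j)" if "i \<in> Obj J" "j \<in> Obj J" "f \<in> Hom J i j" for i j f
    using F that by (auto simp: is_functor_def)
  have PO: "P \<in> Obj C" and pi: "\<And>i. i \<in> Obj J \<Longrightarrow> \<pi> i \<in> Hom C P (F\<^sub>0 i)"
    using P by (auto simp: is_product_def)
  define E where "E = {(F\<^sub>0 j, Comp C P (F\<^sub>0 i) (F\<^sub>0 j) (\<pi> i) (F\<^sub>1 i j f), \<pi> j) |i j f.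
    i \<in> Obj J \<and> j \<in> Obj J \<and> f \<in> Hom J i j}"
  have KE: "is_joint_equalizer C P E K k"
    using K unfolding E_def .
  have KO: "K \<in> Obj C" and k: "k \<in> Hom C K P"
    and eqE: "\<forall>(Y, f, g) \<in> E. Comp C K P Y k f = Comp C K P Y k g"
    using KE unfolding is_joint_equalizer_def by blast+
  have keq: "Comp C K P (F\<^sub>0 j) k (Comp C P (F\<^sub>0 i) (F\<^sub>0 j) (\<pi> i) (F\<^sub>1 i j f)) = Comp C K P (F\<^sub>0 j) k (\<pi> j)"
    if "i \<in> Obj J" "j \<in> Obj J" "f \<in> Hom J i j" for i j f
  proof -
    have "(F\<^sub>0 j, Comp C P (F\<^sub>0 i) (F\<^sub>0 j) (\<pi> i) (F\<^sub>1 i j f), \<pi> j) \<in> E"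
      using that unfolding E_def by blast
    from bspec[OF eqE this] show ?thesis by simp
  qed
  have Kuniv: "\<exists>!h. h \<in> Hom C Z K \<and> Comp C Z K P h k = t"
    if "Z \<in> Obj C" "t \<in> Hom C Z P"
      "\<And>i j f. i \<in> Obj J \<Longrightarrow> j \<in> Obj J \<Longrightarrow> f \<in> Hom J i j \<Longrightarrow>
        Comp C Z P (F\<^sub>0 j) t (Comp C P (F\<^sub>0 i) (F\<^sub>0 j) (\<pi> i) (F\<^sub>1 i j f)) = Comp C Z P (F\<^sub>0 j) t (\<pi> j)"
    for Z t
  proof -
    have "\<forall>(Y, f, g) \<in> E. Comp C Z P Y t f = Comp C Z P Y t g"
      using that(3) unfolding E_def by auto
    then show ?thesis
      using KE that(1,2) unfolding is_joint_equalizer_def by blast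
  qed
  have cone: "is_cone J C F\<^sub>0 F\<^sub>1 K (\<lambda>i. Comp C K P (F\<^sub>0 i) k (\<pi> i))"
    unfolding is_cone_def using KO k pi PO F0 F1 keq
    by (auto intro!: Comp_in_Hom simp: Comp_assoc[where X = K and Y = P])
  have "\<exists>!h. h \<in> Hom C Y K \<and> (\<forall>i \<in> Obj J. Comp C Y K (F\<^sub>0 i) h (Comp C K P (F\<^sub>0 i) k (\<pi> i)) = \<rho> i)"
    if Y: "is_cone J C F\<^sub>0 F\<^sub>1 Y \<rho>" for Y \<rho>
  proof -
    have YO: "Y \<in> Obj C" and rho: "\<And>i. i \<in> Obj J \<Longrightarrow> \<rho> i \<in> Hom C Y (F\<^sub>0 i)"
      and nat: "\<And>i j f. i \<in> Obj J \<Longrightarrow> j \<in> Obj J \<Longrightarrow> f \<in> Hom J i j \<Longrightarrow>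
        Comp C Y (F\<^sub>0 i) (F\<^sub>0 j) (\<rho> i) (F\<^sub>1 i j f) = \<rho> j"
      using Y by (auto simp: is_cone_def)
    have "\<exists>!t. t \<in> Hom C Y P \<and> (\<forall>i \<in> Obj J. Comp C Y P (F\<^sub>0 i) t (\<pi> i) = \<rho> i)"
      using P YO rho by (auto simp: is_product_def)
    then obtain t where t: "t \<in> Hom C Y P" "\<And>i. i \<in> Obj J \<Longrightarrow> Comp C Y P (F\<^sub>0 i) t (\<pi> i) = \<rho> i"
      and tu: "\<And>t'. t' \<in> Hom C Y P \<Longrightarrow> (\<forall>i \<in> Obj J. Comp C Y P (F\<^sub>0 i) t' (\<pi> i) = \<rho> i) \<Longrightarrow> t' = t"
      by (auto elim!: ex1E)
    have eq: "Comp C Y P (F\<^sub>0 j) t (Comp C P (F\<^sub>0 i) (F\<^sub>0 j) (\<pi> i) (F\<^sub>1 i j f)) = Comp C Y P (F\<^sub>0 j) t (\<pi> j)"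
      if "i \<in> Obj J" "j \<in> Obj J" "f \<in> Hom J i j" for i j f
    proof -
      have "Comp C Y P (F\<^sub>0 j) t (Comp C P (F\<^sub>0 i) (F\<^sub>0 j) (\<pi> i) (F\<^sub>1 i j f))
          = Comp C Y (F\<^sub>0 i) (F\<^sub>0 j) (Comp C Y P (F\<^sub>0 i) t (\<pi> i)) (F\<^sub>1 i j f)"
        using that by (intro Comp_assoc[symmetric]) (auto simp: YO PO F0 t pi F1)
      then show ?thesis using that nat t(2) by simp
    qed
    from Kuniv[OF YO t(1) eq] obtain h where h: "h \<in> Hom C Y K" "Comp C Y K P h k = t"
      and hu: "\<And>h'. h' \<in> Hom C Y K \<Longrightarrow> Comp C Y K P h' k = t \<Longrightarrow> h' = h"
      by (auto elim!: ex1E)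
    have assoc: "Comp C Y K (F\<^sub>0 i) h' (Comp C K P (F\<^sub>0 i) k (\<pi> i))
        = Comp C Y P (F\<^sub>0 i) (Comp C Y K P h' k) (\<pi> i)" if "i \<in> Obj J" "h' \<in> Hom C Y K" for i h'
      using that by (intro Comp_assoc[symmetric]) (auto simp: YO KO PO F0 k pi)
    show ?thesis
    proof (rule ex1I[of _ h])
      show "h \<in> Hom C Y K \<and> (\<forall>i \<in> Obj J. Comp C Y K (F\<^sub>0 i) h (Comp C K P (F\<^sub>0 i) k (\<pi> i)) = \<rho> i)"
        using h t assoc by auto
    next
      fix h' assume h': "h' \<in> Hom C Y K
        \<and> (\<forall>i \<in> Obj J. Comp C Y K (F\<^sub>0 i) h' (Comp C K P (F\<^sub>0 i) k (\<pi> i)) = \<rho> i)"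
      then have "Comp C Y P (F\<^sub>0 i) (Comp C Y K P h' k) (\<pi> i) = \<rho> i" if "i \<in> Obj J" for i
        using assoc[OF that, of h'] that by simp
      then have "Comp C Y K P h' k = t"
        using h' Comp_in_Hom[OF YO KO PO _ k] by (intro tu) blast+
      then show "h' = h" using h' hu by auto
    qed
  qed
  then show ?thesis using cone by (auto simp: is_limit_def)
qed

section \<open>Zero objects, biproducts and kernels from products and joint equalizers\<close>

context preadditive_category
begin

lemma HZero_in_Hom: "\<lbrakk>X \<in> Obj C; Y \<in> Obj C\<rbrakk> \<Longrightarrow> HZero C X Y \<in> Hom C X Y"
  using monoid.one_closed[OF group.is_monoid[OF comm_group.axioms(2)[OF hom_comm_group]], of X Y]
  by (simp add: hom_group_def)

lemma HAdd_in_Hom: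
  assumes "X \<in> Obj C" "Y \<in> Obj C" "f \<in> Hom C X Y" "g \<in> Hom C X Y"
  shows "HAdd C X Y f g \<in> Hom C X Y"
proof -
  interpret H: comm_group "hom_group C X Y" by (rule hom_comm_group) fact+
  show ?thesis using H.m_closed assms by (simp add: hom_group_def)
qed

lemma HAdd_HZero:
  assumes "X \<in> Obj C" "Y \<in> Obj C" "f \<in> Hom C X Y"
  shows "HAdd C X Y f (HZero C X Y) = f" "HAdd C X Y (HZero C X Y) f = f"
proof -
  interpret H: comm_group "hom_group C X Y" by (rule hom_comm_group) fact+
  show "HAdd C X Y f (HZero C X Y) = f" "HAdd C X Y (HZero C X Y) f = f"
    using H.r_one[of f] H.l_one[of f] assms by (simp_all add: hom_group_def)
qed

lemma HAdd_idem_is_HZero: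
  assumes "X \<in> Obj C" "Y \<in> Obj C" "f \<in> Hom C X Y" "HAdd C X Y f f = f"
  shows "f = HZero C X Y"
proof -
  interpret H: comm_group "hom_group C X Y" by (rule hom_comm_group) fact+
  show ?thesis using H.r_cancel_one[of f f] assms by (simp add: hom_group_def)
qed

lemma Comp_HZero_left:
  assumes "X \<in> Obj C" "Y \<in> Obj C" "Z \<in> Obj C" "f \<in> Hom C Y Z"
  shows "Comp C X Y Z (HZero C X Y) f = HZero C X Z"
  using Comp_HAdd_left[of X Y Z "HZero C X Y" "HZero C X Y" f] assms
  by (intro HAdd_idem_is_HZero) (auto simp: HAdd_HZero HZero_in_Hom intro!: Comp_in_Hom)

lemma Comp_HZero_right:
  assumes "X \<in> Obj C" "Y \<in> Obj C" "Z \<in> Obj C" "f \<in> Hom C X Y"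
  shows "Comp C X Y Z f (HZero C Y Z) = HZero C X Z"
  using Comp_HAdd_right[of X Y Z f "HZero C Y Z" "HZero C Y Z"] assms
  by (intro HAdd_idem_is_HZero) (auto simp: HAdd_HZero HZero_in_Hom intro!: Comp_in_Hom)

text \<open>
  The empty product \<open>T\<close> is terminal, so its identity is the zero morphism, and every morphism out of
  \<open>T\<close> factors through that identity.
\<close>

lemma zero_object_if_empty_product:
  assumes "is_product C {} X T \<pi>"
  shows "is_zero_object C T"
proof -
  have T: "T \<in> Obj C" and terminal: "\<And>Y. Y \<in> Obj C \<Longrightarrow> \<exists>!h. h \<in> Hom C Y T"
    using assms by (auto simp: is_product_def)
  have id0: "Ident C T = HZero C T T"
    using terminal[OF T] Ident_in_Hom[OF T] HZero_in_Hom[OF T T] by blast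
  have "f = HZero C T Y" if "Y \<in> Obj C" "f \<in> Hom C T Y" for f Y
    using Ident_left[of T Y f] Comp_HZero_left[of T T Y f] that T by (simp add: id0)
  then have "\<exists>!f. f \<in> Hom C T Y" if "Y \<in> Obj C" for Y
    using HZero_in_Hom[OF T that] that by blast
  then show ?thesis using T terminal by (auto simp: is_zero_object_def)
qed

text \<open>
  The injections into a product of two objects have the components \<open>(1, 0)\<close> and \<open>(0, 1)\<close>; the
  identity and \<open>\<pi>\<^sub>1\<iota>\<^sub>1 + \<pi>\<^sub>2\<iota>\<^sub>2\<close> have the same components, hence agree.
\<close>

lemma biproduct_if_product:
  assumes X: "X \<in> Obj C" and Y: "Y \<in> Obj C"
    and "is_product C (UNIV :: bool set) (\<lambda>b. if b then X else Y) P \<pi>"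
  shows "\<exists>P \<iota>\<^sub>1 \<iota>\<^sub>2 \<pi>\<^sub>1 \<pi>\<^sub>2. is_biproduct C X Y P \<iota>\<^sub>1 \<iota>\<^sub>2 \<pi>\<^sub>1 \<pi>\<^sub>2"
proof -
  define p q where "p = \<pi> True" and "q = \<pi> False"
  have P: "P \<in> Obj C" and p: "p \<in> Hom C P X" and q: "q \<in> Hom C P Y"
    using assms by (auto simp: is_product_def p_def q_def all_bool_eq)
  have univ: "\<exists>!h. h \<in> Hom C Z P \<and> Comp C Z P X h p = r \<and> Comp C Z P Y h q = s"
    if "Z \<in> Obj C" "r \<in> Hom C Z X" "s \<in> Hom C Z Y" for Z r s
  proof -
    have "(\<forall>i. (if i then r else s) \<in> Hom C Z (if i then X else Y)) \<longrightarrow>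
      (\<exists>!h. h \<in> Hom C Z P \<and> (\<forall>i. Comp C Z P (if i then X else Y) h (\<pi> i) = (if i then r else s)))"
      using conjunct2[OF conjunct2[OF assms(3)[unfolded is_product_def]], rule_format,
          OF that(1), of "\<lambda>i. if i then r else s"]
      by simp
    then show ?thesis using that by (simp add: all_bool_eq p_def q_def conj_commute)
  qed
  note H = HZero_in_Hom[OF X Y] HZero_in_Hom[OF Y X] Ident_in_Hom[OF X] Ident_in_Hom[OF Y]
  obtain i where i: "i \<in> Hom C X P" "Comp C X P X i p = Ident C X" "Comp C X P Y i q = HZero C X Y"
    using univ[OF X H(3) H(1)] by blast
  obtain j where j: "j \<in> Hom C Y P" "Comp C Y P X j p = HZero C Y X" "Comp C Y P Y j q = Ident C Y"
    using univ[OF Y H(2) H(4)] by blast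
  define a b s where "a = Comp C P X P p i" and "b = Comp C P Y P q j" and "s = HAdd C P P a b"
  have ab: "a \<in> Hom C P P" "b \<in> Hom C P P" and s: "s \<in> Hom C P P"
    unfolding a_def b_def s_def using X Y P p q i j by (auto intro!: Comp_in_Hom HAdd_in_Hom)
  have "Comp C P P X s p = HAdd C P X (Comp C P P X a p) (Comp C P P X b p)"
    unfolding s_def using ab X P p by (intro Comp_HAdd_left)
  also have "Comp C P P X a p = p"
    unfolding a_def using Comp_assoc[OF P X P X p i(1) p] X P p i by (simp add: Ident_right)
  also have "Comp C P P X b p = HZero C P X"
    unfolding b_def using Comp_assoc[OF P Y P X q j(1) p] X Y P p q j by (simp add: Comp_HZero_right)
  finally have sp: "Comp C P P X s p = p"
    using X P p by (simp add: HAdd_HZero)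
  have "Comp C P P Y s q = HAdd C P Y (Comp C P P Y a q) (Comp C P P Y b q)"
    unfolding s_def using ab Y P q by (intro Comp_HAdd_left)
  also have "Comp C P P Y b q = q"
    unfolding b_def using Comp_assoc[OF P Y P Y q j(1) q] Y P q j by (simp add: Ident_right)
  also have "Comp C P P Y a q = HZero C P Y"
    unfolding a_def using Comp_assoc[OF P X P Y p i(1) q] X Y P p q i by (simp add: Comp_HZero_right)
  finally have sq: "Comp C P P Y s q = q"
    using Y P q by (simp add: HAdd_HZero)
  have "s = Ident C P"
    using univ[OF P p q] s sp sq Ident_in_Hom[OF P] Ident_left[OF P X p] Ident_left[OF P Y q] by blast
  then have "is_biproduct C X Y P i j p q"
    unfolding is_biproduct_def using P p q i j by (simp add: s_def a_def b_def)
  then show ?thesis by blast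
qed

lemma kernel_if_joint_equalizer:
  assumes X: "X \<in> Obj C" and Y: "Y \<in> Obj C"
    and "is_joint_equalizer C X {(Y, f, HZero C X Y)} K k"
  shows "is_kernel C X Y f K k"
  using assms unfolding is_joint_equalizer_def is_kernel_def
  by (simp add: Comp_HZero_right)

end

section \<open>Contravariant isomorphisms of categories\<close>

definition opposite_category :: "('i, 'j) category \<Rightarrow> ('i, 'j) category" where
  "opposite_category J = \<lparr>Obj = Obj J, Hom = (\<lambda>i j. Hom J j i), Ident = Ident J,
    Comp = (\<lambda>i j k f g. Comp J k j i g f)\<rparr>"

text \<open>
  The functor and its inverse are inverse to each other on the whole types, and not only on objects
  and morphisms, so that they can be cancelled in any term.
\<close>

locale contravariant_iso =
  fixes C :: "('o, 'a, 'z) preadditive_category_scheme"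
    and D :: "('p, 'b, 'y) preadditive_category_scheme"
    and F :: "'o \<Rightarrow> 'p" and G :: "'p \<Rightarrow> 'o" and \<phi> :: "'a \<Rightarrow> 'b" and \<psi> :: "'b \<Rightarrow> 'a"
  assumes GF: "\<And>X. G (F X) = X" and FG: "\<And>X. F (G X) = X"
    and \<psi>\<phi>: "\<And>f. \<psi> (\<phi> f) = f" and \<phi>\<psi>: "\<And>f. \<phi> (\<psi> f) = f"
    and Obj_iff: "\<And>X. F X \<in> Obj D \<longleftrightarrow> X \<in> Obj C"
    and Hom_iff: "\<And>X Y f. \<phi> f \<in> Hom D (F Y) (F X) \<longleftrightarrow> f \<in> Hom C X Y"
    and Comp_F: "\<And>X Y Z f g. Comp D (F Z) (F Y) (F X) (\<phi> g) (\<phi> f) = \<phi> (Comp C X Y Z f g)"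
    and Ident_F: "\<And>X. Ident D (F X) = \<phi> (Ident C X)"
    and HZero_F: "\<And>X Y. HZero D (F Y) (F X) = \<phi> (HZero C X Y)"
begin

lemma ball_Obj: "(\<forall>Z \<in> Obj D. P Z) \<longleftrightarrow> (\<forall>Z \<in> Obj C. P (F Z))"
  by (metis FG Obj_iff)

lemma ball_Hom: "(\<forall>f \<in> Hom D (F Y) (F X). P f) \<longleftrightarrow> (\<forall>f \<in> Hom C X Y. P (\<phi> f))"
  by (metis \<phi>\<psi> Hom_iff)

lemma ex1_mor: "(\<exists>!f. P f) \<longleftrightarrow> (\<exists>!f. P (\<phi> f))"
  by (metis \<phi>\<psi> \<psi>\<phi>)

lemma \<phi>_eq: "\<phi> f = \<phi> g \<longleftrightarrow> f = g"
  by (metis \<psi>\<phi>)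

lemma is_kernel_iff:
  "is_kernel D (F Y) (F X) (\<phi> f) (F K) (\<phi> k) \<longleftrightarrow> is_cokernel C X Y f K k"
  unfolding is_kernel_def is_cokernel_def by (simp add: ball_Obj ball_Hom Obj_iff Hom_iff Comp_F HZero_F \<phi>_eq
    ex1_mor[where P="\<lambda>h. h \<in> _ \<and> _ h"])

lemma is_cokernel_iff:
  "is_cokernel D (F Y) (F X) (\<phi> f) (F Q) (\<phi> q) \<longleftrightarrow> is_kernel C X Y f Q q"
  unfolding is_kernel_def is_cokernel_def by (simp add: ball_Obj ball_Hom Obj_iff Hom_iff Comp_F HZero_F \<phi>_eq
    ex1_mor[where P="\<lambda>h. h \<in> _ \<and> _ h"])

lemma is_mono_iff: "is_mono D (F Y) (F X) (\<phi> f) \<longleftrightarrow> is_epi C X Y f"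
  unfolding is_mono_def is_epi_def by (simp add: ball_Obj ball_Hom Obj_iff Hom_iff Comp_F \<phi>_eq)

lemma is_epi_iff: "is_epi D (F Y) (F X) (\<phi> f) \<longleftrightarrow> is_mono C X Y f"
  unfolding is_mono_def is_epi_def by (simp add: ball_Obj ball_Hom Obj_iff Hom_iff Comp_F \<phi>_eq)

lemma is_functor_opposite:
  assumes "is_functor J C F\<^sub>0 F\<^sub>1"
  shows "is_functor (opposite_category J) D (\<lambda>i. F (F\<^sub>0 i)) (\<lambda>i j f. \<phi> (F\<^sub>1 j i f))"
  using assms unfolding is_functor_def opposite_category_def
  by (simp add: Obj_iff Hom_iff Comp_F Ident_F \<phi>_eq)

lemma is_cone_iff:
  "is_cone (opposite_category J) D (\<lambda>i. F (F\<^sub>0 i)) (\<lambda>i j f. \<phi> (F\<^sub>1 j i f)) (F X) (\<lambda>i. \<phi> (\<iota> i))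
    \<longleftrightarrow> is_cocone J C F\<^sub>0 F\<^sub>1 X \<iota>"
  unfolding is_cone_def is_cocone_def opposite_category_def
  by (auto simp: Obj_iff Hom_iff Comp_F \<phi>_eq)

lemma is_colimit_if_limit:
  assumes lim: "is_limit (opposite_category J) D (\<lambda>i. F (F\<^sub>0 i)) (\<lambda>i j f. \<phi> (F\<^sub>1 j i f)) X \<pi>"
  shows "is_colimit J C F\<^sub>0 F\<^sub>1 (G X) (\<lambda>i. \<psi> (\<pi> i))"
proof -
  let ?cone = "is_cone (opposite_category J) D (\<lambda>i. F (F\<^sub>0 i)) (\<lambda>i j f. \<phi> (F\<^sub>1 j i f))"
  have cone: "?cone (F (G X)) (\<lambda>i. \<phi> (\<psi> (\<pi> i)))"
    using lim by (simp add: FG \<phi>\<psi> is_limit_def)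
  have "\<exists>!h. h \<in> Hom C (G X) Y \<and> (\<forall>i \<in> Obj J. Comp C (F\<^sub>0 i) (G X) Y (\<psi> (\<pi> i)) h = \<rho> i)"
    if "is_cocone J C F\<^sub>0 F\<^sub>1 Y \<rho>" for Y \<rho>
  proof -
    have "?cone (F Y) (\<lambda>i. \<phi> (\<rho> i))" using that by (simp add: is_cone_iff)
    then have "\<exists>!h. h \<in> Hom D (F Y) (F (G X)) \<and>
        (\<forall>i \<in> Obj J. Comp D (F Y) (F (G X)) (F (F\<^sub>0 i)) h (\<phi> (\<psi> (\<pi> i))) = \<phi> (\<rho> i))"
      using lim unfolding is_limit_def by (simp add: FG \<phi>\<psi> opposite_category_def)
    then show ?thesis
      by (subst (asm) ex1_mor) (simp add: Hom_iff Comp_F \<phi>_eq)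
  qed
  then show ?thesis
    using cone unfolding is_colimit_def by (simp add: is_cone_iff)
qed

end


section \<open>Linear maps and submodules\<close>

definition is_linear ::
  "('r, 'p) ring_scheme \<Rightarrow> ('r, 'm, 'y) module_scheme \<Rightarrow> ('r, 'n, 'z) module_scheme
    \<Rightarrow> ('m \<Rightarrow> 'n) \<Rightarrow> bool" where
  "is_linear R M N f \<longleftrightarrow> f \<in> carrier M \<rightarrow> carrier N \<and>
    (\<forall>x \<in> carrier M. \<forall>y \<in> carrier M. f (x \<oplus>\<^bsub>M\<^esub> y) = f x \<oplus>\<^bsub>N\<^esub> f y) \<and>
    (\<forall>r \<in> carrier R. \<forall>x \<in> carrier M. f (r \<odot>\<^bsub>M\<^esub> x) = r \<odot>\<^bsub>N\<^esub> f x)"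

lemma is_linearI:
  assumes "\<And>x. x \<in> carrier M \<Longrightarrow> f x \<in> carrier N"
    and "\<And>x y. x \<in> carrier M \<Longrightarrow> y \<in> carrier M \<Longrightarrow> f (x \<oplus>\<^bsub>M\<^esub> y) = f x \<oplus>\<^bsub>N\<^esub> f y"
    and "\<And>r x. r \<in> carrier R \<Longrightarrow> x \<in> carrier M \<Longrightarrow> f (r \<odot>\<^bsub>M\<^esub> x) = r \<odot>\<^bsub>N\<^esub> f x"
  shows "is_linear R M N f"
  using assms by (auto simp: is_linear_def)

lemma is_linearD:
  assumes "is_linear R M N f"
  shows "\<And>x. x \<in> carrier M \<Longrightarrow> f x \<in> carrier N"
    and "\<And>x y. x \<in> carrier M \<Longrightarrow> y \<in> carrier M \<Longrightarrow> f (x \<oplus>\<^bsub>M\<^esub> y) = f x \<oplus>\<^bsub>N\<^esub> f y"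
    and "\<And>r x. r \<in> carrier R \<Longrightarrow> x \<in> carrier M \<Longrightarrow> f (r \<odot>\<^bsub>M\<^esub> x) = r \<odot>\<^bsub>N\<^esub> f x"
  using assms by (auto simp: is_linear_def)

lemma left_hom_iff: "f \<in> left_hom R M N \<longleftrightarrow> is_linear R M N f \<and> f \<in> extensional (carrier M)"
  by (auto simp: left_hom_def is_linear_def PiE_def)

lemma left_module_abelian_group: "left_module R M \<Longrightarrow> abelian_group M"
  by (rule left_module.axioms(2))

lemma left_module_closed:
  assumes "left_module R M"
  shows "\<zero>\<^bsub>M\<^esub> \<in> carrier M"
    and "\<And>x y. x \<in> carrier M \<Longrightarrow> y \<in> carrier M \<Longrightarrow> x \<oplus>\<^bsub>M\<^esub> y \<in> carrier M"
    and "\<And>r x. r \<in> carrier R \<Longrightarrow> x \<in> carrier M \<Longrightarrow> r \<odot>\<^bsub>M\<^esub> x \<in> carrier M"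
proof -
  interpret left_module R M by fact
  show "\<zero>\<^bsub>M\<^esub> \<in> carrier M"
    and "\<And>x y. x \<in> carrier M \<Longrightarrow> y \<in> carrier M \<Longrightarrow> x \<oplus>\<^bsub>M\<^esub> y \<in> carrier M"
    and "\<And>r x. r \<in> carrier R \<Longrightarrow> x \<in> carrier M \<Longrightarrow> r \<odot>\<^bsub>M\<^esub> x \<in> carrier M"
    by (auto intro: smult_closed)
qed

lemma left_moduleI:
  assumes "ring R" "abelian_group M"
    and "\<And>r x. r \<in> carrier R \<Longrightarrow> x \<in> carrier M \<Longrightarrow> r \<odot>\<^bsub>M\<^esub> x \<in> carrier M"
    and "\<And>r r' x. \<lbrakk>r \<in> carrier R; r' \<in> carrier R; x \<in> carrier M\<rbrakk>
        \<Longrightarrow> (r \<oplus>\<^bsub>R\<^esub> r') \<odot>\<^bsub>M\<^esub> x = r \<odot>\<^bsub>M\<^esub> x \<oplus>\<^bsub>M\<^esub> r' \<odot>\<^bsub>M\<^esub> x"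
    and "\<And>r x y. \<lbrakk>r \<in> carrier R; x \<in> carrier M; y \<in> carrier M\<rbrakk>
        \<Longrightarrow> r \<odot>\<^bsub>M\<^esub> (x \<oplus>\<^bsub>M\<^esub> y) = r \<odot>\<^bsub>M\<^esub> x \<oplus>\<^bsub>M\<^esub> r \<odot>\<^bsub>M\<^esub> y"
    and "\<And>r r' x. \<lbrakk>r \<in> carrier R; r' \<in> carrier R; x \<in> carrier M\<rbrakk>
        \<Longrightarrow> (r \<otimes>\<^bsub>R\<^esub> r') \<odot>\<^bsub>M\<^esub> x = r \<odot>\<^bsub>M\<^esub> (r' \<odot>\<^bsub>M\<^esub> x)"
    and "\<And>x. x \<in> carrier M \<Longrightarrow> \<one>\<^bsub>R\<^esub> \<odot>\<^bsub>M\<^esub> x = x"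
  shows "left_module R M"
  using assms by (intro left_module.intro left_module_axioms.intro)

lemma left_module_smult_zero:
  assumes "left_module R M" "r \<in> carrier R"
  shows "r \<odot>\<^bsub>M\<^esub> \<zero>\<^bsub>M\<^esub> = \<zero>\<^bsub>M\<^esub>"
proof -
  interpret left_module R M by fact
  have "r \<odot>\<^bsub>M\<^esub> \<zero>\<^bsub>M\<^esub> \<oplus>\<^bsub>M\<^esub> r \<odot>\<^bsub>M\<^esub> \<zero>\<^bsub>M\<^esub> = r \<odot>\<^bsub>M\<^esub> \<zero>\<^bsub>M\<^esub>"
    using smult_r_distr[of r "\<zero>\<^bsub>M\<^esub>" "\<zero>\<^bsub>M\<^esub>"] assms(2) by simp
  then show ?thesis
    using assms(2) by (simp add: M.add.r_cancel_one smult_closed)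
qed

lemma left_module_uminus:
  assumes "left_module R M" "x \<in> carrier M"
  shows "\<ominus>\<^bsub>M\<^esub> x = (\<ominus>\<^bsub>R\<^esub> \<one>\<^bsub>R\<^esub>) \<odot>\<^bsub>M\<^esub> x"
proof -
  interpret left_module R M by fact
  have z: "\<zero>\<^bsub>R\<^esub> \<odot>\<^bsub>M\<^esub> x = \<zero>\<^bsub>M\<^esub>"
    using smult_l_distr[of "\<zero>\<^bsub>R\<^esub>" "\<zero>\<^bsub>R\<^esub>" x] assms(2) by (simp add: M.add.r_cancel_one smult_closed)
  have "(\<ominus>\<^bsub>R\<^esub> \<one>\<^bsub>R\<^esub>) \<odot>\<^bsub>M\<^esub> x \<oplus>\<^bsub>M\<^esub> x = \<zero>\<^bsub>M\<^esub>"
    using smult_l_distr[of "\<ominus>\<^bsub>R\<^esub> \<one>\<^bsub>R\<^esub>" "\<one>\<^bsub>R\<^esub>" x] assms(2) z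
    by (simp add: smult_one R.l_neg)
  then show ?thesis
    using assms(2) by (intro M.minus_equality) (auto simp: smult_closed)
qed

lemma left_module_minus_zero:
  assumes "left_module R M" "x \<in> carrier M"
  shows "x \<ominus>\<^bsub>M\<^esub> \<zero>\<^bsub>M\<^esub> = x"
proof -
  interpret left_module R M by fact
  have "\<ominus>\<^bsub>M\<^esub> \<zero>\<^bsub>M\<^esub> = \<zero>\<^bsub>M\<^esub>"
    by (rule M.minus_equality) auto
  then show ?thesis using assms(2) by (simp add: a_minus_def)
qed

lemma left_module_minus_eq_zero_iff:
  assumes "left_module R M" "x \<in> carrier M" "y \<in> carrier M"
  shows "x \<ominus>\<^bsub>M\<^esub> y = \<zero>\<^bsub>M\<^esub> \<longleftrightarrow> x = y"
proof -
  interpret left_module R M by fact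
  show ?thesis
    using M.minus_equality[of x "\<ominus>\<^bsub>M\<^esub> y"] assms(2,3) by (auto simp: a_minus_def M.r_neg)
qed

lemma is_linear_zero:
  assumes "left_module R M" "left_module R N" "is_linear R M N f"
  shows "f \<zero>\<^bsub>M\<^esub> = \<zero>\<^bsub>N\<^esub>"
proof -
  interpret M: left_module R M by fact
  interpret N: left_module R N by fact
  have "f \<zero>\<^bsub>M\<^esub> \<oplus>\<^bsub>N\<^esub> f \<zero>\<^bsub>M\<^esub> = f \<zero>\<^bsub>M\<^esub>" "f \<zero>\<^bsub>M\<^esub> \<in> carrier N"
    using assms(3) is_linearD(2)[OF assms(3), of "\<zero>\<^bsub>M\<^esub>" "\<zero>\<^bsub>M\<^esub>"] is_linearD(1)[OF assms(3)] by auto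
  then show ?thesis by (simp add: N.add.r_cancel_one)
qed

lemma is_linear_uminus:
  assumes "left_module R M" "left_module R N" "is_linear R M N f" "x \<in> carrier M"
  shows "f (\<ominus>\<^bsub>M\<^esub> x) = \<ominus>\<^bsub>N\<^esub> f x"
proof -
  interpret M: left_module R M by fact
  show ?thesis
    using assms is_linearD[OF assms(3)] by (simp add: left_module_uminus)
qed

lemma is_linear_minus:
  assumes "left_module R M" "left_module R N" "is_linear R M N f" "x \<in> carrier M" "y \<in> carrier M"
  shows "f (x \<ominus>\<^bsub>M\<^esub> y) = f x \<ominus>\<^bsub>N\<^esub> f y"
proof -
  interpret M: left_module R M by fact
  show ?thesis
    using assms is_linearD(2)[OF assms(3), of x "\<ominus>\<^bsub>M\<^esub> y"] by (simp add: a_minus_def is_linear_uminus)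
qed

lemma is_linear_comp:
  assumes "is_linear R M N f" "is_linear R N T g"
  shows "is_linear R M T (\<lambda>x. g (f x))"
  using assms by (auto simp: is_linear_def Pi_iff)

lemma is_linear_cong:
  assumes M: "left_module R M" and f: "is_linear R M N f"
    and eq: "\<And>x. x \<in> carrier M \<Longrightarrow> g x = f x"
  shows "is_linear R M N g"
  by (rule is_linearI) (simp_all add: eq is_linearD[OF f] left_module_closed[OF M])

lemma is_linear_restrict:
  "left_module R M \<Longrightarrow> is_linear R M N f \<Longrightarrow> is_linear R M N (restrict f (carrier M))"
  by (erule (1) is_linear_cong) simp

lemma is_linear_const_zero:
  assumes "left_module R N"
  shows "is_linear R M N (\<lambda>x. \<zero>\<^bsub>N\<^esub>)"
proof -
  interpret N: left_module R N by fact
  show ?thesis by (rule is_linearI) (auto simp: left_module_smult_zero[OF assms])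
qed

lemma is_linear_add:
  assumes "left_module R N" "is_linear R M N f" "is_linear R M N g"
  shows "is_linear R M N (\<lambda>x. f x \<oplus>\<^bsub>N\<^esub> g x)"
proof -
  interpret N: left_module R N by fact
  show ?thesis
    by (rule is_linearI) (auto simp: is_linearD[OF assms(2)] is_linearD[OF assms(3)] N.add.m_ac N.smult_r_distr)
qed

lemma is_linear_neg:
  assumes "left_module R M" "left_module R N" "is_linear R M N f"
  shows "is_linear R M N (\<lambda>x. \<ominus>\<^bsub>N\<^esub> f x)"
proof -
  interpret M: left_module R M by fact
  interpret N: left_module R N by fact
  show ?thesis
  proof (rule is_linearI)
    fix r x assume "r \<in> carrier R" "x \<in> carrier M"
    then show "\<ominus>\<^bsub>N\<^esub> f (r \<odot>\<^bsub>M\<^esub> x) = r \<odot>\<^bsub>N\<^esub> (\<ominus>\<^bsub>N\<^esub> f x)"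
      using is_linear_uminus[OF assms, of "r \<odot>\<^bsub>M\<^esub> x"] is_linear_uminus[OF assms, of x]
        N.smult_r_distr[of r "\<ominus>\<^bsub>N\<^esub> f x" "f x"] left_module_smult_zero[OF assms(2), of r]
      by (auto simp: is_linearD[OF assms(3)] N.smult_closed M.smult_closed N.M.l_neg
          intro!: N.M.minus_equality)
  qed (auto simp: is_linearD[OF assms(3)] N.M.minus_add)
qed

lemma is_linear_finsum_of_maps:
  assumes T: "left_module R T" and f: "\<And>i. i \<in> A \<Longrightarrow> is_linear R M T (f i)" and M: "left_module R M"
  shows "is_linear R M T (\<lambda>x. finsum T (\<lambda>i. f i x) A)"
proof -
  interpret T: left_module R T by fact
  show ?thesis
  proof (cases "finite A")
    case False
    then show ?thesis using is_linear_const_zero[OF T] by (simp add: T.M.finsum_infinite)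
  next
    case True
    then show ?thesis using f
    proof (induction A rule: finite_induct)
      case empty
      then show ?case using is_linear_const_zero[OF T] by simp
    next
      case (insert a A)
      have "is_linear R M T (\<lambda>x. f a x \<oplus>\<^bsub>T\<^esub> finsum T (\<lambda>i. f i x) A)"
        using insert by (intro is_linear_add[OF T]) auto
      then show ?case
        by (rule is_linear_cong[OF M])
          (use insert in \<open>auto intro!: T.M.finsum_insert intro: is_linearD(1)[where R = R and M = M]\<close>)
    qed
  qed
qed

definition is_submodule :: "('r, 'p) ring_scheme \<Rightarrow> ('r, 'm, 'z) module_scheme \<Rightarrow> 'm set \<Rightarrow> bool" where
  "is_submodule R M N \<longleftrightarrow> N \<subseteq> carrier M \<and> \<zero>\<^bsub>M\<^esub> \<in> N \<and>
    (\<forall>x \<in> N. \<forall>y \<in> N. x \<oplus>\<^bsub>M\<^esub> y \<in> N) \<and> (\<forall>r \<in> carrier R. \<forall>x \<in> N. r \<odot>\<^bsub>M\<^esub> x \<in> N)"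

lemma is_submodule_minus:
  assumes M: "left_module R M" and N: "is_submodule R M N" and "x \<in> N" "y \<in> N"
  shows "x \<ominus>\<^bsub>M\<^esub> y \<in> N"
proof -
  interpret left_module R M by fact
  have "\<ominus>\<^bsub>M\<^esub> y \<in> N"
    using assms left_module_uminus[OF M, of y] by (auto simp: is_submodule_def)
  then show ?thesis using assms by (auto simp: a_minus_def is_submodule_def)
qed

lemma left_module_submodule:
  assumes M: "left_module R M" and N: "is_submodule R M N"
  shows "left_module R (M\<lparr>carrier := N\<rparr>)"
proof -
  interpret left_module R M by fact
  have sub: "\<And>x. x \<in> N \<Longrightarrow> x \<in> carrier M" using N by (auto simp: is_submodule_def)
  have neg: "(\<ominus>\<^bsub>R\<^esub> \<one>\<^bsub>R\<^esub>) \<odot>\<^bsub>M\<^esub> x \<in> N" "(\<ominus>\<^bsub>R\<^esub> \<one>\<^bsub>R\<^esub>) \<odot>\<^bsub>M\<^esub> x \<oplus>\<^bsub>M\<^esub> x = \<zero>\<^bsub>M\<^esub>" if "x \<in> N" for x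
    using that N left_module_uminus[OF M sub[OF that]] M.l_neg[OF sub[OF that]] by (auto simp: is_submodule_def)
  have "abelian_group (M\<lparr>carrier := N\<rparr>)"
  proof (rule abelian_groupI)
    fix x assume "x \<in> carrier (M\<lparr>carrier := N\<rparr>)"
    then show "\<exists>y \<in> carrier (M\<lparr>carrier := N\<rparr>). y \<oplus>\<^bsub>M\<lparr>carrier := N\<rparr>\<^esub> x = \<zero>\<^bsub>M\<lparr>carrier := N\<rparr>\<^esub>"
      using neg[of x] by (intro bexI[of _ "(\<ominus>\<^bsub>R\<^esub> \<one>\<^bsub>R\<^esub>) \<odot>\<^bsub>M\<^esub> x"]) simp_all
  qed (use N sub in \<open>auto simp: is_submodule_def M.add.m_ac\<close>)
  then show ?thesis
    by (intro left_moduleI R.ring_axioms)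
      (use N sub in \<open>auto simp: is_submodule_def smult_l_distr smult_r_distr smult_assoc smult_one\<close>)
qed

lemma is_linear_submodule:
  "is_linear R M T f \<Longrightarrow> N \<subseteq> carrier M \<Longrightarrow> is_linear R (M\<lparr>carrier := N\<rparr>) T f"
  by (auto simp: is_linear_def subset_iff)

lemma is_submodule_equalizer:
  assumes M: "left_module R M" and N: "left_module R N"
    and f: "is_linear R M N f" and g: "is_linear R M N g"
  shows "is_submodule R M {x \<in> carrier M. f x = g x}"
proof -
  interpret M: left_module R M by fact
  show ?thesis
    unfolding is_submodule_def
    by (auto simp: is_linearD[OF f] is_linearD[OF g] is_linear_zero[OF M N] f g M.smult_closed)
qed

lemma is_submodule_kernel:
  assumes "left_module R M" "left_module R N" "is_linear R M N f"
  shows "is_submodule R M {x \<in> carrier M. f x = \<zero>\<^bsub>N\<^esub>}"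
  by (rule is_submodule_equalizer[OF assms is_linear_const_zero[OF assms(2)]])

lemma is_submodule_Inter:
  assumes "left_module R M" and "\<And>N. N \<in> \<N> \<Longrightarrow> is_submodule R M N"
  shows "is_submodule R M {x \<in> carrier M. \<forall>N \<in> \<N>. x \<in> N}"
  using assms left_module_closed[OF assms(1)] by (auto simp: is_submodule_def)

lemma is_submodule_image:
  assumes M: "left_module R M" and N: "left_module R N" and f: "is_linear R M N f"
  shows "is_submodule R N (f ` carrier M)"
proof -
  interpret M: left_module R M by fact
  show ?thesis
    unfolding is_submodule_def
    using is_linearD[OF f] is_linear_zero[OF M N f]
    by (auto simp: image_iff) (metis M.M.zero_closed, metis M.M.add.m_closed, metis M.smult_closed)
qed

definition submodule_generated ::
  "('r, 'p) ring_scheme \<Rightarrow> ('r, 'm, 'z) module_scheme \<Rightarrow> 'm set \<Rightarrow> 'm set" where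
  "submodule_generated R M G = {x \<in> carrier M. \<forall>N \<in> {N. is_submodule R M N \<and> G \<subseteq> N}. x \<in> N}"

lemma is_submodule_generated: "left_module R M \<Longrightarrow> is_submodule R M (submodule_generated R M G)"
  unfolding submodule_generated_def by (rule is_submodule_Inter) auto

lemma generated_incl: "G \<subseteq> carrier M \<Longrightarrow> G \<subseteq> submodule_generated R M G"
  by (auto simp: submodule_generated_def)

lemma generated_least: "is_submodule R M N \<Longrightarrow> G \<subseteq> N \<Longrightarrow> submodule_generated R M G \<subseteq> N"
  by (auto simp: submodule_generated_def)

section \<open>Quotients and transport of module structure\<close>

lemma left_module_surjective_image:
  assumes M: "left_module R M" and car: "carrier N = p ` carrier M"
    and add: "\<And>x y. x \<in> carrier M \<Longrightarrow> y \<in> carrier M \<Longrightarrow> p x \<oplus>\<^bsub>N\<^esub> p y = p (x \<oplus>\<^bsub>M\<^esub> y)"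
    and smult: "\<And>r x. r \<in> carrier R \<Longrightarrow> x \<in> carrier M \<Longrightarrow> r \<odot>\<^bsub>N\<^esub> p x = p (r \<odot>\<^bsub>M\<^esub> x)"
    and zero: "\<zero>\<^bsub>N\<^esub> = p \<zero>\<^bsub>M\<^esub>"
  shows "left_module R N"
proof -
  interpret left_module R M by fact
  have "abelian_group N"
  proof (rule abelian_groupI)
    fix a assume "a \<in> carrier N"
    then obtain x where x: "x \<in> carrier M" "a = p x" using car by auto
    then have "p (\<ominus>\<^bsub>M\<^esub> x) \<in> carrier N" "p (\<ominus>\<^bsub>M\<^esub> x) \<oplus>\<^bsub>N\<^esub> a = \<zero>\<^bsub>N\<^esub>"
      using car by (auto simp: add zero M.l_neg)
    then show "\<exists>b \<in> carrier N. b \<oplus>\<^bsub>N\<^esub> a = \<zero>\<^bsub>N\<^esub>" by blast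
  qed (auto simp: car add zero M.add.m_ac)
  then show ?thesis
    by (intro left_moduleI) (auto simp: car add smult smult_closed smult_l_distr smult_r_distr
        smult_assoc smult_one R.ring_axioms)
qed

text \<open>
  The structure that \<open>M\<close> induces along a map \<open>p\<close> whose fibres form a congruence.  Choosing
  representatives as \<open>p\<close> gives quotients, an injective \<open>p\<close> moves \<open>M\<close> to another carrier.
\<close>

definition image_module :: "('r, 'm, 'z) module_scheme \<Rightarrow> ('m \<Rightarrow> 'n) \<Rightarrow> ('r, 'n) module" where
  "image_module M p = (let s = inv_into (carrier M) p in
    \<lparr>carrier = p ` carrier M, mult = (\<lambda>a b. a), one = p \<zero>\<^bsub>M\<^esub>, zero = p \<zero>\<^bsub>M\<^esub>,
     add = (\<lambda>a b. p (s a \<oplus>\<^bsub>M\<^esub> s b)), smult = (\<lambda>r a. p (r \<odot>\<^bsub>M\<^esub> s a))\<rparr>)"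

lemma carrier_image_module [simp]: "carrier (image_module M p) = p ` carrier M"
  by (simp add: image_module_def Let_def)

lemma zero_image_module [simp]: "\<zero>\<^bsub>image_module M p\<^esub> = p \<zero>\<^bsub>M\<^esub>"
  by (simp add: image_module_def Let_def)

lemma left_module_image_module:
  assumes M: "left_module R M"
    and add: "\<And>x x' y y'. \<lbrakk>x \<in> carrier M; x' \<in> carrier M; y \<in> carrier M; y' \<in> carrier M;
      p x = p x'; p y = p y'\<rbrakk> \<Longrightarrow> p (x \<oplus>\<^bsub>M\<^esub> y) = p (x' \<oplus>\<^bsub>M\<^esub> y')"
    and smult: "\<And>r x x'. \<lbrakk>r \<in> carrier R; x \<in> carrier M; x' \<in> carrier M; p x = p x'\<rbrakk>
      \<Longrightarrow> p (r \<odot>\<^bsub>M\<^esub> x) = p (r \<odot>\<^bsub>M\<^esub> x')"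
  shows "left_module R (image_module M p)" "is_linear R M (image_module M p) p"
proof -
  have s: "inv_into (carrier M) p (p x) \<in> carrier M" "p (inv_into (carrier M) p (p x)) = p x"
    if "x \<in> carrier M" for x
    using that by (auto intro: inv_into_into f_inv_into_f)
  have 1: "p x \<oplus>\<^bsub>image_module M p\<^esub> p y = p (x \<oplus>\<^bsub>M\<^esub> y)" if "x \<in> carrier M" "y \<in> carrier M" for x y
    using that by (auto simp: image_module_def Let_def s intro!: add)
  have 2: "r \<odot>\<^bsub>image_module M p\<^esub> p x = p (r \<odot>\<^bsub>M\<^esub> x)" if "r \<in> carrier R" "x \<in> carrier M" for r x
    using that by (auto simp: image_module_def Let_def s intro!: smult)
  show "left_module R (image_module M p)"
    by (rule left_module_surjective_image[OF M]) (auto simp: 1 2)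
  show "is_linear R M (image_module M p) p"
    by (rule is_linearI) (auto simp: 1 2)
qed

lemma left_module_transport:
  assumes M: "left_module R M" and inj: "inj_on p (carrier M)"
  shows "left_module R (image_module M p)" "is_linear R M (image_module M p) p"
  by (rule left_module_image_module[OF M]; use inj in \<open>auto dest: inj_onD\<close>)+

lemma is_linear_inv_transport:
  assumes M: "left_module R M" and inj: "inj_on p (carrier M)"
  shows "is_linear R (image_module M p) M (inv_into (carrier M) p)"
proof -
  interpret left_module R M by fact
  note p = is_linearD(2,3)[OF left_module_transport(2)[OF M inj], symmetric]
  show ?thesis
    by (rule is_linearI) (use inj in \<open>auto simp: p smult_closed\<close>)
qed

text \<open>
  A quotient is realized on a choice of representatives: its carrier is a subset of that of \<open>M\<close>,
  so it stays in the universe.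
\<close>

definition coset_rep :: "('r, 'm, 'z) module_scheme \<Rightarrow> 'm set \<Rightarrow> 'm \<Rightarrow> 'm" where
  "coset_rep M N x = (SOME y. y \<in> carrier M \<and> x \<ominus>\<^bsub>M\<^esub> y \<in> N)"

definition quotient_module :: "('r, 'm, 'z) module_scheme \<Rightarrow> 'm set \<Rightarrow> ('r, 'm) module" where
  "quotient_module M N = image_module M (coset_rep M N)"

lemma coset_rep:
  assumes M: "left_module R M" and N: "is_submodule R M N" and x: "x \<in> carrier M"
  shows "coset_rep M N x \<in> carrier M" "x \<ominus>\<^bsub>M\<^esub> coset_rep M N x \<in> N"
proof -
  interpret left_module R M by fact
  have "x \<in> carrier M \<and> x \<ominus>\<^bsub>M\<^esub> x \<in> N"
    using x N by (simp add: is_submodule_def a_minus_def M.r_neg)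
  then have "coset_rep M N x \<in> carrier M \<and> x \<ominus>\<^bsub>M\<^esub> coset_rep M N x \<in> N"
    unfolding coset_rep_def by (rule someI)
  then show "coset_rep M N x \<in> carrier M" "x \<ominus>\<^bsub>M\<^esub> coset_rep M N x \<in> N" by auto
qed

lemma coset_rep_eq_iff:
  assumes M: "left_module R M" and N: "is_submodule R M N" and x: "x \<in> carrier M" and y: "y \<in> carrier M"
  shows "coset_rep M N x = coset_rep M N y \<longleftrightarrow> x \<ominus>\<^bsub>M\<^esub> y \<in> N"
proof
  interpret left_module R M by fact
  have cancel: "c \<oplus>\<^bsub>M\<^esub> (d \<oplus>\<^bsub>M\<^esub> \<ominus>\<^bsub>M\<^esub> c) = d" if "c \<in> carrier M" "d \<in> carrier M" for c d
    using that by (simp add: M.add.m_comm[of d] M.r_neg2)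
  have sub: "(a \<ominus>\<^bsub>M\<^esub> c) \<ominus>\<^bsub>M\<^esub> (b \<ominus>\<^bsub>M\<^esub> c) = a \<ominus>\<^bsub>M\<^esub> b"
    if "a \<in> carrier M" "b \<in> carrier M" "c \<in> carrier M" for a b c
    using that by (simp add: a_minus_def M.minus_add M.add.m_ac M.r_neg1 M.r_neg2 cancel)
  have sub': "(a \<ominus>\<^bsub>M\<^esub> b) \<oplus>\<^bsub>M\<^esub> (b \<ominus>\<^bsub>M\<^esub> c) = a \<ominus>\<^bsub>M\<^esub> c"
    if "a \<in> carrier M" "b \<in> carrier M" "c \<in> carrier M" for a b c
    using that by (simp add: a_minus_def M.add.m_assoc M.r_neg1 M.r_neg2 cancel)
  show "x \<ominus>\<^bsub>M\<^esub> y \<in> N" if "coset_rep M N x = coset_rep M N y"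
    using is_submodule_minus[OF M N coset_rep(2)[OF M N x] coset_rep(2)[OF M N y]]
      sub[OF x y coset_rep(1)[OF M N y]] that by simp
  assume xy: "x \<ominus>\<^bsub>M\<^esub> y \<in> N"
  have "x \<ominus>\<^bsub>M\<^esub> z \<in> N \<longleftrightarrow> y \<ominus>\<^bsub>M\<^esub> z \<in> N" if z: "z \<in> carrier M" for z
  proof
    assume "y \<ominus>\<^bsub>M\<^esub> z \<in> N"
    then show "x \<ominus>\<^bsub>M\<^esub> z \<in> N" using xy N sub'[OF x y z] by (force simp: is_submodule_def)
  next
    assume "x \<ominus>\<^bsub>M\<^esub> z \<in> N"
    then have "(x \<ominus>\<^bsub>M\<^esub> z) \<ominus>\<^bsub>M\<^esub> (x \<ominus>\<^bsub>M\<^esub> y) \<in> N" by (rule is_submodule_minus[OF M N _ xy])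
    moreover have "(x \<ominus>\<^bsub>M\<^esub> z) \<ominus>\<^bsub>M\<^esub> (x \<ominus>\<^bsub>M\<^esub> y) = y \<ominus>\<^bsub>M\<^esub> z"
      using x y z by (simp add: a_minus_def M.minus_add M.add.m_ac M.r_neg1 M.r_neg2 cancel)
    ultimately show "y \<ominus>\<^bsub>M\<^esub> z \<in> N" by simp
  qed
  then show "coset_rep M N x = coset_rep M N y"
    unfolding coset_rep_def by (metis (no_types, lifting))
qed

lemma carrier_quotient_module: "carrier (quotient_module M N) = coset_rep M N ` carrier M"
  by (simp add: quotient_module_def)

lemma carrier_quotient_subset:
  assumes "left_module R M" "is_submodule R M N"
  shows "carrier (quotient_module M N) \<subseteq> carrier M"
  using coset_rep(1)[OF assms] by (auto simp: carrier_quotient_module)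

lemma left_module_quotient:
  assumes M: "left_module R M" and N: "is_submodule R M N"
  shows "left_module R (quotient_module M N)" "is_linear R M (quotient_module M N) (coset_rep M N)"
proof -
  interpret left_module R M by fact
  have a: "coset_rep M N (x \<oplus>\<^bsub>M\<^esub> y) = coset_rep M N (x' \<oplus>\<^bsub>M\<^esub> y')"
    if "x \<in> carrier M" "x' \<in> carrier M" "y \<in> carrier M" "y' \<in> carrier M"
      "coset_rep M N x = coset_rep M N x'" "coset_rep M N y = coset_rep M N y'" for x x' y y'
  proof -
    have "(x \<ominus>\<^bsub>M\<^esub> x') \<oplus>\<^bsub>M\<^esub> (y \<ominus>\<^bsub>M\<^esub> y') \<in> N"
      using that N by (simp add: coset_rep_eq_iff[OF M N] is_submodule_def)
    moreover have "(x \<ominus>\<^bsub>M\<^esub> x') \<oplus>\<^bsub>M\<^esub> (y \<ominus>\<^bsub>M\<^esub> y') = (x \<oplus>\<^bsub>M\<^esub> y) \<ominus>\<^bsub>M\<^esub> (x' \<oplus>\<^bsub>M\<^esub> y')"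
      using that by (simp add: a_minus_def M.minus_add M.add.m_ac)
    ultimately show ?thesis using that by (simp add: coset_rep_eq_iff[OF M N])
  qed
  have b: "coset_rep M N (r \<odot>\<^bsub>M\<^esub> x) = coset_rep M N (r \<odot>\<^bsub>M\<^esub> x')"
    if "r \<in> carrier R" "x \<in> carrier M" "x' \<in> carrier M" "coset_rep M N x = coset_rep M N x'" for r x x'
  proof -
    have "r \<odot>\<^bsub>M\<^esub> (x \<ominus>\<^bsub>M\<^esub> x') \<in> N"
      using that N by (simp add: coset_rep_eq_iff[OF M N] is_submodule_def)
    moreover have "r \<odot>\<^bsub>M\<^esub> (\<ominus>\<^bsub>M\<^esub> x') = \<ominus>\<^bsub>M\<^esub> (r \<odot>\<^bsub>M\<^esub> x')"
      using that smult_r_distr[of r "\<ominus>\<^bsub>M\<^esub> x'" x'] left_module_smult_zero[OF M, of r]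
      by (intro M.minus_equality[symmetric]) (auto simp: smult_closed M.l_neg)
    ultimately show ?thesis
      using that by (simp add: coset_rep_eq_iff[OF M N] smult_closed a_minus_def smult_r_distr)
  qed
  show "left_module R (quotient_module M N)" "is_linear R M (quotient_module M N) (coset_rep M N)"
    unfolding quotient_module_def by (rule left_module_image_module[OF M a b]; assumption)+
qed

lemma linear_coset_rep:
  assumes M: "left_module R M" and N: "is_submodule R M N" and T: "left_module R T"
    and f: "is_linear R M T f" and ker: "N \<subseteq> {x \<in> carrier M. f x = \<zero>\<^bsub>T\<^esub>}" and x: "x \<in> carrier M"
  shows "f (coset_rep M N x) = f x"
proof -
  interpret T: left_module R T by fact
  note r = coset_rep[OF M N x]
  have "f x \<ominus>\<^bsub>T\<^esub> f (coset_rep M N x) = \<zero>\<^bsub>T\<^esub>"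
    using r ker is_linear_minus[OF M T f x r(1)] by auto
  then show ?thesis
    using is_linearD(1)[OF f] r(1) x left_module_minus_eq_zero_iff[OF T] by simp
qed

text \<open>
  Since a quotient consists of representatives, the map induced by \<open>f\<close> on it is \<open>f\<close> itself.
\<close>

lemma is_linear_from_quotient:
  assumes M: "left_module R M" and N: "is_submodule R M N" and T: "left_module R T"
    and f: "is_linear R M T f" and ker: "N \<subseteq> {x \<in> carrier M. f x = \<zero>\<^bsub>T\<^esub>}"
  shows "is_linear R (quotient_module M N) T f"
proof -
  interpret left_module R M by fact
  note c = linear_coset_rep[OF assms]
  note p = is_linearD(2,3)[OF left_module_quotient(2)[OF M N], symmetric]
  show ?thesis
    by (rule is_linearI) (auto simp: carrier_quotient_module c p is_linearD[OF f] smult_closed)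
qed

lemma linear_factor_through_surjection:
  assumes M: "left_module R M" and N: "left_module R N" 
    and p: "is_linear R M N p" and surj: "p ` carrier M = carrier N"
    and f: "is_linear R M T f"
    and cong: "\<And>x y. x \<in> carrier M \<Longrightarrow> y \<in> carrier M \<Longrightarrow> p x = p y \<Longrightarrow> f x = f y"
  shows "\<exists>h. is_linear R N T h \<and> (\<forall>x \<in> carrier M. h (p x) = f x)"
proof -
  interpret left_module R M by fact
  define h where "h a = f (inv_into (carrier M) p a)" for a
  have h: "h (p x) = f x" if "x \<in> carrier M" for x
    unfolding h_def using that by (intro cong) (auto intro: inv_into_into f_inv_into_f)
  have "is_linear R N T h"
    by (rule is_linearI)
      (auto simp: surj[symmetric] h is_linearD[OF f] is_linearD(2,3)[OF p, symmetric] smult_closed)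
  then show ?thesis using h by blast
qed

lemma linear_lift_through_injection:
  assumes M: "left_module R M" and N: "left_module R N" and T: "left_module R T"
    and i: "is_linear R M N i" and inj: "inj_on i (carrier M)"
    and f: "is_linear R T N f" and im: "\<And>t. t \<in> carrier T \<Longrightarrow> f t \<in> i ` carrier M"
  shows "\<exists>h. is_linear R T M h \<and> (\<forall>t \<in> carrier T. i (h t) = f t)"
proof -
  interpret M: left_module R M by fact
  interpret T: left_module R T by fact
  define h where "h t = inv_into (carrier M) i (f t)" for t
  have h: "h t \<in> carrier M" "i (h t) = f t" if "t \<in> carrier T" for t
    unfolding h_def using im[OF that] by (auto intro: inv_into_into f_inv_into_f)
  have "is_linear R T M h"
    by (rule is_linearI)
      (auto intro!: inj_onD[OF inj] simp: h is_linearD[OF f] is_linearD(2,3)[OF i]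
        T.smult_closed M.smult_closed)
  then show ?thesis using h by blast
qed

section \<open>Products and direct sums of modules\<close>

definition product_module :: "'i set \<Rightarrow> ('i \<Rightarrow> ('r, 'm, 'z) module_scheme) \<Rightarrow> ('r, 'i \<Rightarrow> 'm) module" where
  "product_module I M = \<lparr>carrier = (\<Pi>\<^sub>E i \<in> I. carrier (M i)), mult = (\<lambda>x y. x),
    one = (\<lambda>i \<in> I. \<zero>\<^bsub>M i\<^esub>), zero = (\<lambda>i \<in> I. \<zero>\<^bsub>M i\<^esub>),
    add = (\<lambda>x y. \<lambda>i \<in> I. x i \<oplus>\<^bsub>M i\<^esub> y i), smult = (\<lambda>r x. \<lambda>i \<in> I. r \<odot>\<^bsub>M i\<^esub> x i)\<rparr>"

lemma product_module_simps [simp]: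
  "carrier (product_module I M) = (\<Pi>\<^sub>E i \<in> I. carrier (M i))"
  "\<zero>\<^bsub>product_module I M\<^esub> = (\<lambda>i \<in> I. \<zero>\<^bsub>M i\<^esub>)"
  "x \<oplus>\<^bsub>product_module I M\<^esub> y = (\<lambda>i \<in> I. x i \<oplus>\<^bsub>M i\<^esub> y i)"
  "r \<odot>\<^bsub>product_module I M\<^esub> x = (\<lambda>i \<in> I. r \<odot>\<^bsub>M i\<^esub> x i)"
  by (simp_all add: product_module_def)

lemma left_module_product:
  assumes R: "ring R" and M: "\<And>i. i \<in> I \<Longrightarrow> left_module R (M i)"
  shows "left_module R (product_module I M)"
proof -
  note cl = left_module_closed[OF M]
  note ag = left_module_abelian_group[OF M]
  have "abelian_group (product_module I M)"
  proof (rule abelian_groupI)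
    fix x assume x: "x \<in> carrier (product_module I M)"
    let ?y = "\<lambda>i \<in> I. \<ominus>\<^bsub>M i\<^esub> x i"
    have "?y \<in> carrier (product_module I M)"
      using x abelian_group.a_inv_closed[OF ag] by (auto simp: PiE_iff)
    moreover have "?y \<oplus>\<^bsub>product_module I M\<^esub> x = \<zero>\<^bsub>product_module I M\<^esub>"
      using x abelian_group.l_neg[OF ag] by (auto simp: PiE_iff)
    ultimately show "\<exists>y \<in> carrier (product_module I M).
        y \<oplus>\<^bsub>product_module I M\<^esub> x = \<zero>\<^bsub>product_module I M\<^esub>" by blast
  next
    fix x y z assume "x \<in> carrier (product_module I M)" "y \<in> carrier (product_module I M)"
      "z \<in> carrier (product_module I M)"
    then show "x \<oplus>\<^bsub>product_module I M\<^esub> y \<oplus>\<^bsub>product_module I M\<^esub> z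
        = x \<oplus>\<^bsub>product_module I M\<^esub> (y \<oplus>\<^bsub>product_module I M\<^esub> z)"
      using abelian_monoid.a_assoc[OF abelian_group.axioms(1)[OF ag]] by (auto simp: PiE_iff)
  next
    fix x y assume "x \<in> carrier (product_module I M)" "y \<in> carrier (product_module I M)"
    then show "x \<oplus>\<^bsub>product_module I M\<^esub> y = y \<oplus>\<^bsub>product_module I M\<^esub> x"
      using abelian_monoid.a_comm[OF abelian_group.axioms(1)[OF ag]] by (auto simp: PiE_iff)
  next
    fix x assume "x \<in> carrier (product_module I M)"
    then show "\<zero>\<^bsub>product_module I M\<^esub> \<oplus>\<^bsub>product_module I M\<^esub> x = x"
      using abelian_monoid.l_zero[OF abelian_group.axioms(1)[OF ag]]
      by (auto simp: PiE_iff fun_eq_iff extensional_def)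
  qed (auto simp: PiE_iff cl)
  then show ?thesis
  proof (intro left_moduleI R)
    fix x assume "x \<in> carrier (product_module I M)"
    then show "\<one>\<^bsub>R\<^esub> \<odot>\<^bsub>product_module I M\<^esub> x = x"
      by (auto simp: PiE_iff fun_eq_iff extensional_def left_module.smult_one[OF M])
  qed (auto simp: PiE_iff cl left_module.smult_l_distr[OF M] left_module.smult_r_distr[OF M]
      left_module.smult_assoc[OF M])
qed

lemma is_linear_projection: "i \<in> I \<Longrightarrow> is_linear R (product_module I M) (M i) (\<lambda>x. x i)"
  by (rule is_linearI) auto

lemma is_linear_into_product:
  assumes f: "\<And>i. i \<in> I \<Longrightarrow> is_linear R T (M i) (f i)"
  shows "is_linear R T (product_module I M) (\<lambda>t. \<lambda>i \<in> I. f i t)"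
  by (rule is_linearI) (auto simp: is_linearD[OF f] fun_eq_iff)

definition finite_supports :: "'i set \<Rightarrow> ('i \<Rightarrow> ('r, 'm, 'z) module_scheme) \<Rightarrow> ('i \<Rightarrow> 'm) set" where
  "finite_supports I M = {x \<in> (\<Pi>\<^sub>E i \<in> I. carrier (M i)). finite {i \<in> I. x i \<noteq> \<zero>\<^bsub>M i\<^esub>}}"

definition direct_sum :: "'i set \<Rightarrow> ('i \<Rightarrow> ('r, 'm, 'z) module_scheme) \<Rightarrow> ('r, 'i \<Rightarrow> 'm) module" where
  "direct_sum I M = (product_module I M)\<lparr>carrier := finite_supports I M\<rparr>"

lemma direct_sum_simps [simp]:
  "carrier (direct_sum I M) = finite_supports I M"
  "\<zero>\<^bsub>direct_sum I M\<^esub> = (\<lambda>i \<in> I. \<zero>\<^bsub>M i\<^esub>)"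
  "x \<oplus>\<^bsub>direct_sum I M\<^esub> y = (\<lambda>i \<in> I. x i \<oplus>\<^bsub>M i\<^esub> y i)"
  "r \<odot>\<^bsub>direct_sum I M\<^esub> x = (\<lambda>i \<in> I. r \<odot>\<^bsub>M i\<^esub> x i)"
  by (simp_all add: direct_sum_def product_module_def)

lemma left_module_direct_sum:
  assumes R: "ring R" and M: "\<And>i. i \<in> I \<Longrightarrow> left_module R (M i)"
  shows "left_module R (direct_sum I M)"
proof -
  note cl = left_module_closed[OF M]
  have z: "\<zero>\<^bsub>M i\<^esub> \<oplus>\<^bsub>M i\<^esub> \<zero>\<^bsub>M i\<^esub> = \<zero>\<^bsub>M i\<^esub>" if "i \<in> I" for i
    using abelian_monoid.l_zero[OF abelian_group.axioms(1)[OF left_module_abelian_group[OF M[OF that]]]]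
      cl(1)[OF that] by blast
  have "is_submodule R (product_module I M) (finite_supports I M)"
    unfolding is_submodule_def
  proof (intro conjI ballI)
    fix x y assume x: "x \<in> finite_supports I M" and y: "y \<in> finite_supports I M"
    have "{i \<in> I. x i \<oplus>\<^bsub>M i\<^esub> y i \<noteq> \<zero>\<^bsub>M i\<^esub>}
        \<subseteq> {i \<in> I. x i \<noteq> \<zero>\<^bsub>M i\<^esub>} \<union> {i \<in> I. y i \<noteq> \<zero>\<^bsub>M i\<^esub>}"
      by (auto simp: z)
    then have "finite {i \<in> I. x i \<oplus>\<^bsub>M i\<^esub> y i \<noteq> \<zero>\<^bsub>M i\<^esub>}"
      by (rule finite_subset) (use x y in \<open>auto simp: finite_supports_def\<close>)
    then show "x \<oplus>\<^bsub>product_module I M\<^esub> y \<in> finite_supports I M"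
      using x y by (auto simp: finite_supports_def PiE_iff cl elim!: finite_subset[rotated])
  next
    fix r x assume r: "r \<in> carrier R" and x: "x \<in> finite_supports I M"
    have "{i \<in> I. r \<odot>\<^bsub>M i\<^esub> x i \<noteq> \<zero>\<^bsub>M i\<^esub>} \<subseteq> {i \<in> I. x i \<noteq> \<zero>\<^bsub>M i\<^esub>}"
      using left_module_smult_zero[OF M r] by auto
    then have "finite {i \<in> I. r \<odot>\<^bsub>M i\<^esub> x i \<noteq> \<zero>\<^bsub>M i\<^esub>}"
      by (rule finite_subset) (use x in \<open>auto simp: finite_supports_def\<close>)
    then show "r \<odot>\<^bsub>product_module I M\<^esub> x \<in> finite_supports I M"
      using r x by (auto simp: finite_supports_def PiE_iff cl elim!: finite_subset[rotated])
  qed (use cl in \<open>auto simp: finite_supports_def PiE_iff extensional_def\<close>)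
  then show ?thesis
    unfolding direct_sum_def by (intro left_module_submodule left_module_product R M)
qed

definition summand_incl :: "'i set \<Rightarrow> ('i \<Rightarrow> ('r, 'm, 'z) module_scheme) \<Rightarrow> 'i \<Rightarrow> 'm \<Rightarrow> 'i \<Rightarrow> 'm" where
  "summand_incl I M i v = (\<lambda>j \<in> I. if j = i then v else \<zero>\<^bsub>M j\<^esub>)"

lemma is_linear_summand_incl:
  assumes M: "\<And>i. i \<in> I \<Longrightarrow> left_module R (M i)" and i: "i \<in> I"
  shows "is_linear R (M i) (direct_sum I M) (summand_incl I M i)"
proof (rule is_linearI)
  fix v assume v: "v \<in> carrier (M i)"
  have "{j \<in> I. summand_incl I M i v j \<noteq> \<zero>\<^bsub>M j\<^esub>} \<subseteq> {i}"
    by (auto simp: summand_incl_def)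
  then have "finite {j \<in> I. summand_incl I M i v j \<noteq> \<zero>\<^bsub>M j\<^esub>}"
    by (rule finite_subset) simp
  then show "summand_incl I M i v \<in> carrier (direct_sum I M)"
    using v left_module_closed(1)[OF M] by (auto simp: finite_supports_def summand_incl_def)
next
  fix v w assume "v \<in> carrier (M i)" "w \<in> carrier (M i)"
  have "\<zero>\<^bsub>M i\<^esub> \<oplus>\<^bsub>M i\<^esub> \<zero>\<^bsub>M i\<^esub> = \<zero>\<^bsub>M i\<^esub>" if "i \<in> I" for i
    using abelian_monoid.l_zero[OF abelian_group.axioms(1)[OF left_module_abelian_group[OF M[OF that]]]]
      left_module_closed(1)[OF M[OF that]] by blast
  then show "summand_incl I M i (v \<oplus>\<^bsub>M i\<^esub> w)
      = summand_incl I M i v \<oplus>\<^bsub>direct_sum I M\<^esub> summand_incl I M i w"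
    by (auto simp: summand_incl_def fun_eq_iff)
next
  fix r v assume "r \<in> carrier R" "v \<in> carrier (M i)"
  then show "summand_incl I M i (r \<odot>\<^bsub>M i\<^esub> v) = r \<odot>\<^bsub>direct_sum I M\<^esub> summand_incl I M i v"
    using left_module_smult_zero[OF M] by (auto simp: summand_incl_def fun_eq_iff)
qed

text \<open>
  By induction on a finite set containing the support, splitting off one value at a time.
\<close>

lemma direct_sum_generated:
  assumes R: "ring R" and M: "\<And>i. i \<in> I \<Longrightarrow> left_module R (M i)"
    and N: "is_submodule R (direct_sum I M) N"
    and inc: "\<And>i v. i \<in> I \<Longrightarrow> v \<in> carrier (M i) \<Longrightarrow> summand_incl I M i v \<in> N"
  shows "finite_supports I M \<subseteq> N"
proof
  fix x assume x: "x \<in> finite_supports I M"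
  have "x \<in> N" if "finite A" "x \<in> finite_supports I M" "{i \<in> I. x i \<noteq> \<zero>\<^bsub>M i\<^esub>} \<subseteq> A" for A x
    using that
  proof (induction A arbitrary: x rule: finite_induct)
    case empty
    then have "x = \<zero>\<^bsub>direct_sum I M\<^esub>"
      by (auto simp: finite_supports_def PiE_iff extensional_def fun_eq_iff)
    then show ?case using N by (simp only: is_submodule_def)
  next
    case (insert a A)
    show ?case
    proof (cases "a \<in> I")
      case True
      interpret Ma: left_module R "M a" by (rule M[OF True])
      define y where "y = x(a := \<zero>\<^bsub>M a\<^esub>)"
      have xa: "x a \<in> carrier (M a)" using insert True by (auto simp: finite_supports_def)
      have "finite {i \<in> I. y i \<noteq> \<zero>\<^bsub>M i\<^esub>}"
        by (rule finite_subset[of _ "{i \<in> I. x i \<noteq> \<zero>\<^bsub>M i\<^esub>}"])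
          (use insert in \<open>auto simp: y_def finite_supports_def\<close>)
      then have y: "y \<in> finite_supports I M"
        using insert(4) True by (auto simp: finite_supports_def PiE_iff y_def extensional_def)
      have "y \<in> N"
        using insert.prems by (intro insert.IH y) (auto simp: y_def)
      have "x i \<in> carrier (M i)" "x i = \<zero>\<^bsub>M i\<^esub> \<oplus>\<^bsub>M i\<^esub> x i" if "i \<in> I" for i
        using insert(4) that left_module_abelian_group[OF M[OF that]]
        by (auto simp: finite_supports_def PiE_iff abelian_monoid.l_zero[OF abelian_group.axioms(1)])
      then have "x = summand_incl I M a (x a) \<oplus>\<^bsub>direct_sum I M\<^esub> y"
        using insert(4) True xa
        by (auto simp: summand_incl_def y_def fun_eq_iff finite_supports_def PiE_iff extensional_def)
      then show ?thesis
        using N inc[OF True xa] \<open>y \<in> N\<close> unfolding is_submodule_def by metis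
    next
      case False
      then show ?thesis using insert.prems by (intro insert.IH) auto
    qed
  qed
  then show "x \<in> N" using x by (auto simp: finite_supports_def)
qed

lemma linear_eq_on_direct_sum:
  assumes R: "ring R" and M: "\<And>i. i \<in> I \<Longrightarrow> left_module R (M i)" and T: "left_module R T"
    and f: "is_linear R (direct_sum I M) T f" and g: "is_linear R (direct_sum I M) T g"
    and eq: "\<And>i v. i \<in> I \<Longrightarrow> v \<in> carrier (M i) \<Longrightarrow> f (summand_incl I M i v) = g (summand_incl I M i v)"
    and x: "x \<in> finite_supports I M"
  shows "f x = g x"
proof -
  have "finite_supports I M \<subseteq> {x \<in> carrier (direct_sum I M). f x = g x}"
    by (rule direct_sum_generated[OF R M is_submodule_equalizer[OF left_module_direct_sum[OF R M] T f g]])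
      (use eq is_linearD(1)[OF is_linear_summand_incl[OF M]] in auto)
  then show ?thesis using x by auto
qed

text \<open>
  The map out of a direct sum that is induced by maps \<open>g i\<close> on the summands.
\<close>

definition sum_map ::
  "('r, 'n, 'y) module_scheme \<Rightarrow> 'i set \<Rightarrow> ('i \<Rightarrow> ('r, 'm, 'z) module_scheme)
    \<Rightarrow> ('i \<Rightarrow> 'm \<Rightarrow> 'n) \<Rightarrow> ('i \<Rightarrow> 'm) \<Rightarrow> 'n" where
  "sum_map T I M g x = finsum T (\<lambda>i. g i (x i)) {i \<in> I. x i \<noteq> \<zero>\<^bsub>M i\<^esub>}"

lemma sum_map_eq:
  assumes M: "\<And>i. i \<in> I \<Longrightarrow> left_module R (M i)" and T: "left_module R T"
    and g: "\<And>i. i \<in> I \<Longrightarrow> is_linear R (M i) T (g i)"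
    and x: "x \<in> finite_supports I M"
    and A: "finite A" "{i \<in> I. x i \<noteq> \<zero>\<^bsub>M i\<^esub>} \<subseteq> A" "A \<subseteq> I"
  shows "sum_map T I M g x = finsum T (\<lambda>i. g i (x i)) A"
proof -
  interpret T: left_module R T by fact
  have "g i (x i) \<in> carrier T" if "i \<in> I" for i
    using that x is_linearD(1)[OF g] by (auto simp: finite_supports_def)
  then show ?thesis
    unfolding sum_map_def
    using A is_linear_zero[OF M T g] by (intro T.M.add.finprod_mono_neutral_cong_left) auto
qed

lemma is_linear_sum_map:
  assumes R: "ring R" and M: "\<And>i. i \<in> I \<Longrightarrow> left_module R (M i)" and T: "left_module R T"
    and g: "\<And>i. i \<in> I \<Longrightarrow> is_linear R (M i) T (g i)"
  shows "is_linear R (direct_sum I M) T (sum_map T I M g)"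
proof -
  interpret T: left_module R T by fact
  note cl = left_module_closed[OF left_module_direct_sum[OF R M], simplified]
  note eq = sum_map_eq[OF M T g]
  have gc: "g i (x i) \<in> carrier T" "x i \<in> carrier (M i)" if "i \<in> I" "x \<in> finite_supports I M" for i x
    using that is_linearD(1)[OF g] by (auto simp: finite_supports_def)
  have fin: "finite {i \<in> I. x i \<noteq> \<zero>\<^bsub>M i\<^esub>}" if "x \<in> finite_supports I M" for x
    using that by (simp add: finite_supports_def)
  show ?thesis
  proof (rule is_linearI)
    fix x assume "x \<in> carrier (direct_sum I M)"
    then show "sum_map T I M g x \<in> carrier T"
      unfolding sum_map_def by (intro T.M.finsum_closed) (auto simp: gc)
  next
    fix x y assume "x \<in> carrier (direct_sum I M)" "y \<in> carrier (direct_sum I M)"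
    then have x: "x \<in> finite_supports I M" and y: "y \<in> finite_supports I M" by auto
    let ?z = "\<lambda>i \<in> I. x i \<oplus>\<^bsub>M i\<^esub> y i"
    have z: "?z \<in> finite_supports I M" using cl(2)[OF _ x y] by simp
    define A where "A = {i \<in> I. x i \<noteq> \<zero>\<^bsub>M i\<^esub>} \<union> {i \<in> I. y i \<noteq> \<zero>\<^bsub>M i\<^esub>} \<union> {i \<in> I. ?z i \<noteq> \<zero>\<^bsub>M i\<^esub>}"
    have A: "finite A" "A \<subseteq> I"
      unfolding A_def using fin[OF x] fin[OF y] fin[OF z] by auto
    have sub: "{i \<in> I. x i \<noteq> \<zero>\<^bsub>M i\<^esub>} \<subseteq> A" "{i \<in> I. y i \<noteq> \<zero>\<^bsub>M i\<^esub>} \<subseteq> A"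
      "{i \<in> I. ?z i \<noteq> \<zero>\<^bsub>M i\<^esub>} \<subseteq> A"
      unfolding A_def by auto
    have "finsum T (\<lambda>i. g i (?z i)) A = finsum T (\<lambda>i. g i (x i) \<oplus>\<^bsub>T\<^esub> g i (y i)) A"
      using A x y by (intro T.M.finsum_cong') (auto simp: gc is_linearD(2)[OF g] subset_iff)
    also have "\<dots> = finsum T (\<lambda>i. g i (x i)) A \<oplus>\<^bsub>T\<^esub> finsum T (\<lambda>i. g i (y i)) A"
      using A x y by (intro T.M.finsum_addf) (auto simp: gc subset_iff)
    finally show "sum_map T I M g (x \<oplus>\<^bsub>direct_sum I M\<^esub> y) = sum_map T I M g x \<oplus>\<^bsub>T\<^esub> sum_map T I M g y"
      using eq[OF _ _ x A(1) _ A(2)] eq[OF _ _ y A(1) _ A(2)] eq[OF _ _ z A(1) _ A(2)] sub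
      by simp
  next
    fix r x assume r: "r \<in> carrier R" and "x \<in> carrier (direct_sum I M)"
    then have x: "x \<in> finite_supports I M" by auto
    let ?z = "\<lambda>i \<in> I. r \<odot>\<^bsub>M i\<^esub> x i" and ?A = "{i \<in> I. x i \<noteq> \<zero>\<^bsub>M i\<^esub>}"
    have z: "?z \<in> finite_supports I M" using cl(3)[OF _ r x] by simp
    have "sum_map T I M g ?z = finsum T (\<lambda>i. g i (?z i)) ?A"
      using left_module_smult_zero[OF M r] by (intro eq[OF _ _ z]) (auto simp: fin[OF x])
    also have "\<dots> = finsum T (\<lambda>i. r \<odot>\<^bsub>T\<^esub> g i (x i)) ?A"
      using x r by (intro T.M.finsum_cong') (auto simp: gc is_linearD(3)[OF g] T.smult_closed)
    also have "\<dots> = r \<odot>\<^bsub>T\<^esub> finsum T (\<lambda>i. g i (x i)) ?A"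
    proof -
      have "finsum T (\<lambda>i. r \<odot>\<^bsub>T\<^esub> g i (x i)) B = r \<odot>\<^bsub>T\<^esub> finsum T (\<lambda>i. g i (x i)) B"
        if "finite B" "B \<subseteq> I" for B
        using that
      proof (induction B rule: finite_induct)
        case empty
        then show ?case using r by (simp add: left_module_smult_zero[OF T])
      next
        case (insert b B)
        have "(\<lambda>i. g i (x i)) \<in> B \<rightarrow> carrier T" "(\<lambda>i. r \<odot>\<^bsub>T\<^esub> g i (x i)) \<in> B \<rightarrow> carrier T"
          using insert x r by (auto simp: gc T.smult_closed subset_iff)
        then show ?case
          using insert x r by (simp add: gc T.smult_closed T.smult_r_distr T.M.finsum_closed)
      qed
      then show ?thesis using fin[OF x] by simp
    qed
    finally show "sum_map T I M g (r \<odot>\<^bsub>direct_sum I M\<^esub> x) = r \<odot>\<^bsub>T\<^esub> sum_map T I M g x"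
      by (simp add: sum_map_def)
  qed
qed

lemma sum_map_summand_incl:
  assumes M: "\<And>i. i \<in> I \<Longrightarrow> left_module R (M i)" and T: "left_module R T"
    and g: "\<And>i. i \<in> I \<Longrightarrow> is_linear R (M i) T (g i)"
    and i: "i \<in> I" and v: "v \<in> carrier (M i)"
  shows "sum_map T I M g (summand_incl I M i v) = g i v"
proof -
  interpret T: left_module R T by fact
  have lin: "is_linear R (M i) (direct_sum I M) (summand_incl I M i)"
    by (rule is_linear_summand_incl) (use M i in auto)
  have "summand_incl I M i v \<in> finite_supports I M"
    using is_linearD(1)[OF lin v] by simp
  then have "sum_map T I M g (summand_incl I M i v)
      = finsum T (\<lambda>j. g j (summand_incl I M i v j)) {i}"
    using i by (intro sum_map_eq[where R = R] M T g) (auto simp: summand_incl_def)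
  also have "\<dots> = g i v"
    using is_linearD(1)[OF g[OF i] v] i by (simp add: summand_incl_def)
  finally show ?thesis .
qed


section \<open>Opposite rings, modules and bimaps\<close>

definition opposite_ring :: "('r, 'p) ring_scheme \<Rightarrow> ('r, 'p) ring_scheme" where
  "opposite_ring R = R\<lparr>mult := \<lambda>x y. y \<otimes>\<^bsub>R\<^esub> x\<rparr>"

lemma opposite_ring_simps [simp]:
  "carrier (opposite_ring R) = carrier R" "\<zero>\<^bsub>opposite_ring R\<^esub> = \<zero>\<^bsub>R\<^esub>" "\<one>\<^bsub>opposite_ring R\<^esub> = \<one>\<^bsub>R\<^esub>"
  "x \<oplus>\<^bsub>opposite_ring R\<^esub> y = x \<oplus>\<^bsub>R\<^esub> y" "x \<otimes>\<^bsub>opposite_ring R\<^esub> y = y \<otimes>\<^bsub>R\<^esub> x"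
  "opposite_ring (opposite_ring R) = R"
  by (simp_all add: opposite_ring_def)

lemma abelian_group_cong:
  assumes "abelian_group M"
    and "carrier N = carrier M" "zero N = zero M" "add N = add M"
  shows "abelian_group N"
proof -
  interpret M: abelian_group M by fact
  show ?thesis
    by (rule abelian_groupI) (use assms(2-4) M.add.l_inv_ex in \<open>auto simp: M.add.m_ac\<close>)
qed

lemma ring_opposite:
  assumes "ring R"
  shows "ring (opposite_ring R)"
proof -
  interpret ring R by fact
  have "abelian_group (opposite_ring R)"
    by (rule abelian_group_cong[OF abelian_group_axioms]) (simp_all add: opposite_ring_def)
  moreover have "Group.monoid (opposite_ring R)"
    by (rule monoidI) (auto simp: m_assoc)
  ultimately show ?thesis
    by (rule ringI) (auto simp: l_distr r_distr)
qed

definition left_of :: "('s, 'm) right_module \<Rightarrow> ('s, 'm) module" where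
  "left_of V = \<lparr>carrier = carrier V, mult = mult V, one = one V, zero = zero V, add = add V,
    smult = (\<lambda>s v. v \<triangleleft>\<^bsub>V\<^esub> s)\<rparr>"

definition right_of :: "('s, 'm) module \<Rightarrow> ('s, 'm) right_module" where
  "right_of V = \<lparr>carrier = carrier V, mult = mult V, one = one V, zero = zero V, add = add V,
    ract = (\<lambda>v s. s \<odot>\<^bsub>V\<^esub> v)\<rparr>"

lemma left_right_of_simps [simp]:
  "carrier (left_of V) = carrier V" "zero (left_of V) = zero V" "add (left_of V) = add V"
  "s \<odot>\<^bsub>left_of V\<^esub> v = v \<triangleleft>\<^bsub>V\<^esub> s"
  "carrier (right_of M) = carrier M" "zero (right_of M) = zero M" "add (right_of M) = add M"
  "v \<triangleleft>\<^bsub>right_of M\<^esub> s = s \<odot>\<^bsub>M\<^esub> v"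
  "left_of (right_of M) = M" "right_of (left_of V) = V"
  by (simp_all add: left_of_def right_of_def)

lemma right_module_iff: "right_module S V \<longleftrightarrow> left_module (opposite_ring S) (left_of V)"
proof
  assume "right_module S V"
  then interpret right_module S V .
  show "left_module (opposite_ring S) (left_of V)"
    by (intro left_moduleI ring_opposite S.ring_axioms abelian_group_cong[OF M.abelian_group_axioms])
      (auto simp: ract_closed ract_l_distr ract_r_distr ract_assoc ract_one)
next
  assume "left_module (opposite_ring S) (left_of V)"
  then interpret left_module "opposite_ring S" "left_of V" .
  have "ring S" using ring_opposite[OF R.ring_axioms] by simp
  then show "right_module S V"
    by (intro right_module.intro right_module_axioms.intro abelian_group_cong[OF M.abelian_group_axioms])
      (use smult_closed smult_l_distr smult_r_distr smult_assoc smult_one in simp_all)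
qed

lemma right_hom_iff:
  "f \<in> right_hom S M N \<longleftrightarrow>
    is_linear (opposite_ring S) (left_of M) (left_of N) f \<and> f \<in> extensional (carrier M)"
  by (auto simp: right_hom_def is_linear_def PiE_def)

definition opposite_bimodule :: "('r, 's, 'w) bimodule \<Rightarrow> ('s, 'r, 'w) bimodule" where
  "opposite_bimodule W = \<lparr>carrier = carrier W, mult = mult W, one = one W, zero = zero W, add = add W,
    smult = (\<lambda>s w. bract W w s), bract = (\<lambda>w r. r \<odot>\<^bsub>W\<^esub> w)\<rparr>"

lemma opposite_bimodule_simps [simp]:
  "carrier (opposite_bimodule W) = carrier W" "zero (opposite_bimodule W) = zero W"
  "add (opposite_bimodule W) = add W" "s \<odot>\<^bsub>opposite_bimodule W\<^esub> w = bract W w s"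
  "bract (opposite_bimodule W) w r = r \<odot>\<^bsub>W\<^esub> w"
  "opposite_bimodule (opposite_bimodule W) = W"
  by (simp_all add: opposite_bimodule_def)

lemma left_module_cong:
  assumes "left_module R M" "carrier N = carrier M" "zero N = zero M" "add N = add M" "smult N = smult M"
  shows "left_module R N"
  by (rule left_module_surjective_image[where p = "\<lambda>x. x", OF assms(1)]) (simp_all add: assms)

lemma is_bimodule_left: "is_bimodule R S W \<Longrightarrow> left_module R W"
  by (simp add: is_bimodule_def)

lemma is_bimodule_right:
  assumes "is_bimodule R S W"
  shows "left_module (opposite_ring S) (opposite_bimodule W)"
proof -
  have "left_module (opposite_ring S) (left_of (right_part W))"
    using assms by (simp add: is_bimodule_def right_module_iff)
  then show ?thesis
    by (rule left_module_cong) (simp_all add: right_part_def fun_eq_iff)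
qed

lemma is_bimodule_opposite:
  assumes "is_bimodule R S W"
  shows "is_bimodule (opposite_ring S) (opposite_ring R) (opposite_bimodule W)"
proof -
  have "left_module R (left_of (right_part (opposite_bimodule W)))"
    by (rule left_module_cong[OF is_bimodule_left[OF assms]])
      (simp_all add: right_part_def fun_eq_iff)
  then show ?thesis
    using is_bimodule_right[OF assms] assms by (simp add: is_bimodule_def right_module_iff)
qed

text \<open>
  With right modules read as left modules over the opposite ring, a bimap is a function that is
  linear in each variable, a description symmetric in the two sides.
\<close>

lemma is_bimap_iff:
  "is_bimap R S W B \<longleftrightarrow>
    left_module R (LMod B) \<and> left_module (opposite_ring S) (left_of (RMod B)) \<and>
    (\<forall>u \<in> carrier (LMod B).
      is_linear (opposite_ring S) (left_of (RMod B)) (opposite_bimodule W) (bmap B u)) \<and>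
    (\<forall>v \<in> carrier (RMod B). is_linear R (LMod B) W (\<lambda>u. bmap B u v))"
  by (auto simp: is_bimap_def Let_def right_module_iff is_linear_def Pi_iff)

lemma adjoint_morphisms_iff:
  "f \<in> adjoint_morphisms R S B C \<longleftrightarrow>
    is_linear R (LMod B) (LMod C) (fst f) \<and> fst f \<in> extensional (carrier (LMod B)) \<and>
    is_linear (opposite_ring S) (left_of (RMod C)) (left_of (RMod B)) (snd f) \<and>
    snd f \<in> extensional (carrier (RMod C)) \<and>
    (\<forall>u \<in> carrier (LMod B). \<forall>v \<in> carrier (RMod C). bmap C (fst f u) v = bmap B u (snd f v))"
  by (cases f) (simp add: adjoint_morphisms_def left_hom_iff right_hom_iff)

lemma Adj_simps:
  "X \<in> Obj (Adj \<U> R S W) \<longleftrightarrow>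
    is_bimap R S W X \<and> carrier (LMod X) \<in> \<U> \<and> carrier (RMod X) \<in> \<U>"
  "Hom (Adj \<U> R S W) = adjoint_morphisms R S"
  "Ident (Adj \<U> R S W) X = (\<lambda>u \<in> carrier (LMod X). u, \<lambda>v \<in> carrier (RMod X). v)"
  "Comp (Adj \<U> R S W) X Y Z f g =
    (\<lambda>u \<in> carrier (LMod X). fst g (fst f u), \<lambda>v \<in> carrier (RMod Z). snd f (snd g v))"
  "HAdd (Adj \<U> R S W) X Y f g =
    (\<lambda>u \<in> carrier (LMod X). fst f u \<oplus>\<^bsub>LMod Y\<^esub> fst g u,
     \<lambda>v \<in> carrier (RMod Y). snd f v \<oplus>\<^bsub>RMod X\<^esub> snd g v)"
  "HZero (Adj \<U> R S W) X Y =
    (\<lambda>u \<in> carrier (LMod X). \<zero>\<^bsub>LMod Y\<^esub>, \<lambda>v \<in> carrier (RMod Y). \<zero>\<^bsub>RMod X\<^esub>)"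
  by (simp_all add: Adj_def case_prod_beta)

definition opposite_bimap :: "('r, 's, 'm, 'w) bimap \<Rightarrow> ('s, 'r, 'm, 'w) bimap" where
  "opposite_bimap B = \<lparr>LMod = left_of (RMod B), RMod = right_of (LMod B), bmap = (\<lambda>u v. bmap B v u)\<rparr>"

lemma opposite_bimap_simps [simp]:
  "LMod (opposite_bimap B) = left_of (RMod B)" "RMod (opposite_bimap B) = right_of (LMod B)"
  "bmap (opposite_bimap B) u v = bmap B v u" "opposite_bimap (opposite_bimap B) = B"
  by (simp_all add: opposite_bimap_def)

text \<open>
  The two components of a morphism point in opposite directions, so swapping them together with the
  two sides of the bimaps reverses the arrows.
\<close>

lemma Adj_contravariant_iso:
  "contravariant_iso (Adj \<U> R S W)
    (Adj \<U> (opposite_ring S) (opposite_ring R) (opposite_bimodule W))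
    opposite_bimap opposite_bimap prod.swap prod.swap"
  by unfold_locales (auto simp: Adj_simps is_bimap_iff adjoint_morphisms_iff opposite_bimap_def eta_contract_eq)

section \<open>The adjoint category is preadditive\<close>

locale adjoint_category =
  fixes R :: "('r, 'p) ring_scheme" and S :: "('s, 'q) ring_scheme"
    and W :: "('r, 's, 'w) bimodule" and \<U> :: "'m set set"
  assumes bimodule: "is_bimodule R S W" and universe: "set_universe \<U>"
begin

abbreviation "A \<equiv> Adj \<U> R S W"
abbreviation "S' \<equiv> opposite_ring S"
abbreviation "W' \<equiv> opposite_bimodule W"
abbreviation "rmod X \<equiv> left_of (RMod X)"

lemma W_left: "left_module R W"
  using bimodule by (rule is_bimodule_left)

lemma W_right: "left_module S' W'"
  using bimodule by (rule is_bimodule_right)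

lemma ring_R: "ring R"
  using W_left by (simp add: left_module_def)

lemma ring_S': "ring S'"
  using W_right by (simp add: left_module_def)

lemma Obj_D:
  assumes "X \<in> Obj A"
  shows "left_module R (LMod X)" "left_module S' (rmod X)"
    and "\<And>u. u \<in> carrier (LMod X) \<Longrightarrow> is_linear S' (rmod X) W' (bmap X u)"
    and "\<And>v. v \<in> carrier (RMod X) \<Longrightarrow> is_linear R (LMod X) W (\<lambda>u. bmap X u v)"
    and "carrier (LMod X) \<in> \<U>" "carrier (RMod X) \<in> \<U>"
  using assms by (auto simp: Adj_simps is_bimap_iff)

lemma Hom_D:
  assumes "f \<in> Hom A X Y"
  shows "is_linear R (LMod X) (LMod Y) (fst f)" "is_linear S' (rmod Y) (rmod X) (snd f)"
    and "\<And>u v. u \<in> carrier (LMod X) \<Longrightarrow> v \<in> carrier (RMod Y) \<Longrightarrow> bmap Y (fst f u) v = bmap X u (snd f v)"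
    and "\<And>u. u \<in> carrier (LMod X) \<Longrightarrow> fst f u \<in> carrier (LMod Y)"
    and "\<And>v. v \<in> carrier (RMod Y) \<Longrightarrow> snd f v \<in> carrier (RMod X)"
  using assms is_linearD(1)[of R "LMod X" "LMod Y" "fst f"] is_linearD(1)[of S' "rmod Y" "rmod X" "snd f"]
  by (auto simp: Adj_simps adjoint_morphisms_iff)

lemma Hom_restrictI:
  assumes X: "X \<in> Obj A" and Y: "Y \<in> Obj A"
    and f: "is_linear R (LMod X) (LMod Y) f" and g: "is_linear S' (rmod Y) (rmod X) g"
    and "\<And>u v. u \<in> carrier (LMod X) \<Longrightarrow> v \<in> carrier (RMod Y) \<Longrightarrow> bmap Y (f u) v = bmap X u (g v)"
  shows "(restrict f (carrier (LMod X)), restrict g (carrier (RMod Y))) \<in> Hom A X Y"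
  using assms(5) is_linear_restrict[OF Obj_D(1)[OF X] f] is_linear_restrict[OF Obj_D(2)[OF Y] g]
  by (auto simp: Adj_simps adjoint_morphisms_iff)

lemma Hom_eqI:
  assumes f: "f \<in> Hom A X Y" and g: "g \<in> Hom A X Y"
    and "\<And>u. u \<in> carrier (LMod X) \<Longrightarrow> fst f u = fst g u"
    and "\<And>v. v \<in> carrier (RMod Y) \<Longrightarrow> snd f v = snd g v"
  shows "f = g"
  using assms by (intro prod_eqI extensionalityI) (auto simp: Adj_simps adjoint_morphisms_iff)

lemma Comp_eq_iff:
  assumes "f \<in> Hom A X Z"
  shows "Comp A X Y Z g h = f \<longleftrightarrow>
    (\<forall>u \<in> carrier (LMod X). fst h (fst g u) = fst f u) \<and>
    (\<forall>v \<in> carrier (RMod Z). snd g (snd h v) = snd f v)"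
  using assms by (auto simp: Adj_simps adjoint_morphisms_iff prod_eq_iff fun_eq_iff extensional_def)

lemma Adj_category: "category A"
proof
  fix X assume X: "X \<in> Obj A"
  have "is_linear R (LMod X) (LMod X) (\<lambda>u. u)" "is_linear S' (rmod X) (rmod X) (\<lambda>v. v)"
    by (auto intro: is_linearI)
  then have "(\<lambda>u \<in> carrier (LMod X). u, \<lambda>v \<in> carrier (RMod X). v) \<in> Hom A X X"
    by (intro Hom_restrictI X) auto
  then show "Ident A X \<in> Hom A X X" by (simp add: Adj_simps)
next
  fix X Y Z f g assume XYZ: "X \<in> Obj A" "Y \<in> Obj A" "Z \<in> Obj A" and f: "f \<in> Hom A X Y" and g: "g \<in> Hom A Y Z"
  show "Comp A X Y Z f g \<in> Hom A X Z"
    unfolding Adj_simps(4)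
    by (intro Hom_restrictI XYZ is_linear_comp[OF Hom_D(1)[OF f] Hom_D(1)[OF g]]
        is_linear_comp[OF Hom_D(2)[OF g] Hom_D(2)[OF f]])
      (simp add: Hom_D[OF f] Hom_D[OF g])
next
  fix X Y f assume "X \<in> Obj A" "Y \<in> Obj A" and f: "f \<in> Hom A X Y"
  then show "Comp A X X Y (Ident A X) f = f" "Comp A X Y Y f (Ident A Y) = f"
    by (auto simp: Comp_eq_iff[OF f]) (auto simp: Adj_simps Hom_D[OF f])
next
  fix X Y Z T f g h assume f: "f \<in> Hom A X Y" and g: "g \<in> Hom A Y Z" and h: "h \<in> Hom A Z T"
  then show "Comp A X Z T (Comp A X Y Z f g) h = Comp A X Y T f (Comp A Y Z T g h)"
    by (auto simp: Adj_simps(4) fun_eq_iff Hom_D[OF f] Hom_D[OF h])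
qed

sublocale category A by (rule Adj_category)

lemma Adj_hom_comm_group:
  assumes X: "X \<in> Obj A" and Y: "Y \<in> Obj A"
  shows "comm_group (hom_group A X Y)"
proof -
  note X' = Obj_D[OF X] and Y' = Obj_D[OF Y]
  interpret XL: left_module R "LMod X" by (rule X')
  interpret XR: left_module S' "rmod X" by (rule X')
  interpret YL: left_module R "LMod Y" by (rule Y')
  interpret YR: left_module S' "rmod Y" by (rule Y')
  interpret WL: left_module R W by (rule W_left)
  have b_add: "bmap Y (u \<oplus>\<^bsub>LMod Y\<^esub> u') v = bmap Y u v \<oplus>\<^bsub>W\<^esub> bmap Y u' v"
    if "u \<in> carrier (LMod Y)" "u' \<in> carrier (LMod Y)" "v \<in> carrier (RMod Y)" for u u' v
    using is_linearD(2)[OF Y'(4)[OF that(3)]] that by simp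
  have b_add': "bmap X u (v \<oplus>\<^bsub>RMod X\<^esub> v') = bmap X u v \<oplus>\<^bsub>W\<^esub> bmap X u v'"
    if "u \<in> carrier (LMod X)" "v \<in> carrier (RMod X)" "v' \<in> carrier (RMod X)" for u v v'
    using is_linearD(2)[OF X'(3)[OF that(1)]] that by simp
  have b0: "bmap Y \<zero>\<^bsub>LMod Y\<^esub> v = \<zero>\<^bsub>W\<^esub>" if "v \<in> carrier (RMod Y)" for v
    using is_linear_zero[OF Y'(1) W_left Y'(4)[OF that]] by simp
  have b0': "bmap X u \<zero>\<^bsub>RMod X\<^esub> = \<zero>\<^bsub>W\<^esub>" if "u \<in> carrier (LMod X)" for u
    using is_linear_zero[OF X'(2) W_right X'(3)[OF that]] by simp
  have add: "HAdd A X Y f g \<in> Hom A X Y" if f: "f \<in> Hom A X Y" and g: "g \<in> Hom A X Y" for f g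
    using is_linear_add[OF Y'(1) Hom_D(1)[OF f] Hom_D(1)[OF g]]
      is_linear_add[OF X'(2) Hom_D(2)[OF f] Hom_D(2)[OF g]] unfolding Adj_simps(5)
    by (intro Hom_restrictI X Y) (simp_all add: b_add b_add' Hom_D[OF f] Hom_D[OF g])
  have zero: "HZero A X Y \<in> Hom A X Y"
    using is_linear_const_zero[OF Y'(1)] is_linear_const_zero[OF X'(2)] unfolding Adj_simps(6)
    by (intro Hom_restrictI X Y) (simp_all add: b0 b0')
  define neg :: "('m \<Rightarrow> 'm) \<times> ('m \<Rightarrow> 'm) \<Rightarrow> ('m \<Rightarrow> 'm) \<times> ('m \<Rightarrow> 'm)" where
    "neg f = (\<lambda>u \<in> carrier (LMod X). \<ominus>\<^bsub>LMod Y\<^esub> fst f u, \<lambda>v \<in> carrier (RMod Y). \<ominus>\<^bsub>rmod X\<^esub> snd f v)" for f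
  have neg: "neg f \<in> Hom A X Y" if f: "f \<in> Hom A X Y" for f
    unfolding neg_def
  proof (intro Hom_restrictI X Y)
    fix u v assume uv: "u \<in> carrier (LMod X)" "v \<in> carrier (RMod Y)"
    have "bmap Y (\<ominus>\<^bsub>LMod Y\<^esub> fst f u) v = \<ominus>\<^bsub>W\<^esub> bmap Y (fst f u) v"
      using is_linear_uminus[OF Y'(1) W_left Y'(4)] uv Hom_D(4)[OF f] by blast
    also have "\<dots> = \<ominus>\<^bsub>W'\<^esub> bmap X u (snd f v)"
      using Hom_D(3)[OF f uv] by (simp add: a_inv_def m_inv_def)
    also have "\<dots> = bmap X u (\<ominus>\<^bsub>rmod X\<^esub> snd f v)"
      using is_linear_uminus[OF X'(2) W_right X'(3)[OF uv(1)], of "snd f v"] uv Hom_D(5)[OF f] by simp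
    finally show "bmap Y (\<ominus>\<^bsub>LMod Y\<^esub> fst f u) v = bmap X u (\<ominus>\<^bsub>rmod X\<^esub> snd f v)" .
  qed (rule is_linear_neg X' Y' Hom_D[OF f])+
  show ?thesis
  proof (rule comm_groupI)
    fix f g h assume "f \<in> carrier (hom_group A X Y)" "g \<in> carrier (hom_group A X Y)" "h \<in> carrier (hom_group A X Y)"
    then have f: "f \<in> Hom A X Y" and g: "g \<in> Hom A X Y" and h: "h \<in> Hom A X Y" by (auto simp: hom_group_def)
    show "f \<otimes>\<^bsub>hom_group A X Y\<^esub> g \<otimes>\<^bsub>hom_group A X Y\<^esub> h = f \<otimes>\<^bsub>hom_group A X Y\<^esub> (g \<otimes>\<^bsub>hom_group A X Y\<^esub> h)"
      using YL.M.a_assoc XR.M.a_assoc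
      by (auto simp: hom_group_def Adj_simps(5) fun_eq_iff Hom_D[OF f] Hom_D[OF g] Hom_D[OF h])
  next
    fix f g assume "f \<in> carrier (hom_group A X Y)" "g \<in> carrier (hom_group A X Y)"
    then have f: "f \<in> Hom A X Y" and g: "g \<in> Hom A X Y" by (auto simp: hom_group_def)
    show "f \<otimes>\<^bsub>hom_group A X Y\<^esub> g = g \<otimes>\<^bsub>hom_group A X Y\<^esub> f"
      using YL.M.a_comm XR.M.a_comm
      by (auto simp: hom_group_def Adj_simps(5) fun_eq_iff Hom_D[OF f] Hom_D[OF g])
  next
    fix f assume "f \<in> carrier (hom_group A X Y)"
    then have f: "f \<in> Hom A X Y" by (auto simp: hom_group_def)
    have "HAdd A X Y (HZero A X Y) f = f"
      by (rule Hom_eqI[OF add[OF zero f] f])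
        (use YL.M.l_zero XR.M.l_zero in \<open>auto simp: Adj_simps(5,6) Hom_D[OF f]\<close>)
    then show "\<one>\<^bsub>hom_group A X Y\<^esub> \<otimes>\<^bsub>hom_group A X Y\<^esub> f = f" by (simp add: hom_group_def)
    have "HAdd A X Y (neg f) f = HZero A X Y"
      by (rule Hom_eqI[OF add[OF neg[OF f] f] zero])
        (use YL.M.l_neg XR.M.l_neg in \<open>auto simp: Adj_simps(5,6) neg_def Hom_D[OF f]\<close>)
    then show "\<exists>g \<in> carrier (hom_group A X Y). g \<otimes>\<^bsub>hom_group A X Y\<^esub> f = \<one>\<^bsub>hom_group A X Y\<^esub>"
      using neg[OF f] by (auto simp: hom_group_def)
  qed (auto simp: hom_group_def add zero)
qed

lemma Adj_preadditive: "preadditive_category A"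
proof (intro preadditive_category.intro preadditive_category_axioms.intro Adj_category)
  fix X Y Z f f' g
  assume X: "X \<in> Obj A" and Y: "Y \<in> Obj A" and Z: "Z \<in> Obj A"
    and f: "f \<in> Hom A X Y" and f': "f' \<in> Hom A X Y" and g: "g \<in> Hom A Y Z"
  then show "Comp A X Y Z (HAdd A X Y f f') g = HAdd A X Z (Comp A X Y Z f g) (Comp A X Y Z f' g)"
    by (auto simp: Adj_simps(4,5) fun_eq_iff Hom_D[OF f] Hom_D[OF f'] Hom_D[OF g]
        is_linearD(2)[OF Hom_D(1)[OF g]])
next
  fix X Y Z f g g'
  assume X: "X \<in> Obj A" and Y: "Y \<in> Obj A" and Z: "Z \<in> Obj A"
    and f: "f \<in> Hom A X Y" and g: "g \<in> Hom A Y Z" and g': "g' \<in> Hom A Y Z"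
  then show "Comp A X Y Z f (HAdd A Y Z g g') = HAdd A X Z (Comp A X Y Z f g) (Comp A X Y Z f g')"
    using is_linearD(2)[OF Hom_D(2)[OF f]]
    by (auto simp: Adj_simps(4,5) fun_eq_iff Hom_D[OF f] Hom_D[OF g] Hom_D[OF g'])
qed (rule Adj_hom_comm_group)

sublocale preadditive_category A by (rule Adj_preadditive)

end


section \<open>Joint equalizers in the adjoint category\<close>

context adjoint_category
begin

definition equalizer_set :: "('r, 's, 'm, 'w) bimap
    \<Rightarrow> (('r, 's, 'm, 'w) bimap \<times> (('m \<Rightarrow> 'm) \<times> ('m \<Rightarrow> 'm)) \<times> (('m \<Rightarrow> 'm) \<times> ('m \<Rightarrow> 'm))) set \<Rightarrow> 'm set" where
  "equalizer_set X E = {u \<in> carrier (LMod X). \<forall>(Y, f, g) \<in> E. fst f u = fst g u}"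

definition coequalizing_submodule :: "('r, 's, 'm, 'w) bimap
    \<Rightarrow> (('r, 's, 'm, 'w) bimap \<times> (('m \<Rightarrow> 'm) \<times> ('m \<Rightarrow> 'm)) \<times> (('m \<Rightarrow> 'm) \<times> ('m \<Rightarrow> 'm))) set \<Rightarrow> 'm set" where
  "coequalizing_submodule X E = submodule_generated S' (rmod X)
    {snd f v \<ominus>\<^bsub>rmod X\<^esub> snd g v |Y f g v. (Y, f, g) \<in> E \<and> v \<in> carrier (RMod Y)}"

definition equalizer_object where
  "equalizer_object X E = \<lparr>LMod = (LMod X)\<lparr>carrier := equalizer_set X E\<rparr>,
    RMod = right_of (quotient_module (rmod X) (coequalizing_submodule X E)), bmap = bmap X\<rparr>"

definition equalizer_map where
  "equalizer_map X E = (\<lambda>u \<in> equalizer_set X E. u,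
    \<lambda>v \<in> carrier (RMod X). coset_rep (rmod X) (coequalizing_submodule X E) v)"

text \<open>
  For \<open>u\<close> in the equalizer set and a generator \<open>fv - gv\<close> of the submodule, adjointness moves \<open>f\<close> and
  \<open>g\<close> to \<open>u\<close>, where they agree; so \<open>u\<close> pairs to zero with the submodule and the bimap of \<open>X\<close>
  descends to the quotient.  Since the quotient consists of representatives, it is even the same
  function.
\<close>

lemma joint_equalizer:
  assumes X: "X \<in> Obj A"
    and E: "\<And>Y f g. (Y, f, g) \<in> E \<Longrightarrow> Y \<in> Obj A \<and> f \<in> Hom A X Y \<and> g \<in> Hom A X Y"
  shows "is_joint_equalizer A X E (equalizer_object X E) (equalizer_map X E)"
proof -
  note X' = Obj_D[OF X]
  interpret XR: left_module S' "rmod X" by (rule X')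
  define U where "U = equalizer_set X E"
  define N where "N = coequalizing_submodule X E"
  define K where "K = equalizer_object X E"
  define k where "k = equalizer_map X E"
  (* N_ker is the universal property of the right quotient; it is used for the values of the bimap
     and for the right component of a morphism that equalizes E. *)
  define Gen where
    "Gen = {snd f v \<ominus>\<^bsub>rmod X\<^esub> snd g v |Y f g v. (Y, f, g) \<in> E \<and> v \<in> carrier (RMod Y)}"
  have K_simps: "LMod K = (LMod X)\<lparr>carrier := U\<rparr>" "RMod K = right_of (quotient_module (rmod X) N)"
    "bmap K = bmap X"
    by (simp_all add: K_def U_def N_def equalizer_object_def)
  have k_simps: "fst k = (\<lambda>u \<in> U. u)" "snd k = (\<lambda>v \<in> carrier (RMod X). coset_rep (rmod X) N v)"
    by (simp_all add: k_def U_def N_def equalizer_map_def)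
  have U_sub: "U \<subseteq> carrier (LMod X)"
    by (auto simp: U_def equalizer_set_def)
  have U: "is_submodule R (LMod X) U"
  proof -
    have "U = {u \<in> carrier (LMod X). \<forall>N \<in> (\<lambda>(Y, f, g). {u \<in> carrier (LMod X). fst f u = fst g u}) ` E. u \<in> N}"
      by (auto simp: U_def equalizer_set_def)
    also have "is_submodule R (LMod X) \<dots>"
    proof (rule is_submodule_Inter[OF X'(1)])
      fix M assume "M \<in> (\<lambda>(Y, f, g). {u \<in> carrier (LMod X). fst f u = fst g u}) ` E"
      then obtain Y f g where M: "(Y, f, g) \<in> E" "M = {u \<in> carrier (LMod X). fst f u = fst g u}"
        by auto
      then show "is_submodule R (LMod X) M"
        using is_submodule_equalizer[OF X'(1) Obj_D(1) Hom_D(1) Hom_D(1)] E[OF M(1)] by blast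
    qed
    finally show ?thesis .
  qed
  have N: "is_submodule S' (rmod X) N"
    unfolding N_def coequalizing_submodule_def by (rule is_submodule_generated[OF X'(2)])
  have Gen: "Gen \<subseteq> carrier (rmod X)"
  proof
    fix x assume "x \<in> Gen"
    then obtain Y f g v where EY: "(Y, f, g) \<in> E" "v \<in> carrier (RMod Y)"
      and x: "x = snd f v \<ominus>\<^bsub>rmod X\<^esub> snd g v"
      by (auto simp: Gen_def)
    have "snd f v \<in> carrier (rmod X)" "snd g v \<in> carrier (rmod X)"
      using E[OF EY(1)] Hom_D(5)[OF _ EY(2)] by auto
    then show "x \<in> carrier (rmod X)"
      unfolding x by (rule XR.M.minus_closed)
  qed
  have N_incl: "Gen \<subseteq> N"
    using generated_incl[OF Gen] by (simp add: N_def coequalizing_submodule_def Gen_def)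
  have N_ker: "N \<subseteq> {v \<in> carrier (rmod X). p v = \<zero>\<^bsub>T\<^esub>}"
    if T: "left_module S' T" and p: "is_linear S' (rmod X) T p"
      and eq: "\<And>Y f g v. (Y, f, g) \<in> E \<Longrightarrow> v \<in> carrier (RMod Y) \<Longrightarrow> p (snd f v) = p (snd g v)"
    for T :: "('s, 'n, 'z) module_scheme" and p
  proof -
    interpret T: left_module S' T by (rule T)
    have "p (snd f v \<ominus>\<^bsub>rmod X\<^esub> snd g v) = \<zero>\<^bsub>T\<^esub>" if "(Y, f, g) \<in> E" "v \<in> carrier (RMod Y)" for Y f g v
    proof -
      have c: "snd f v \<in> carrier (rmod X)" "snd g v \<in> carrier (rmod X)"
        using E[OF that(1)] Hom_D(5)[OF _ that(2)] by auto
      then show ?thesis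
        using is_linear_minus[OF X'(2) T p c] eq[OF that] is_linearD(1)[OF p] c
        by (simp add: left_module_minus_eq_zero_iff[OF T])
    qed
    then have "p x = \<zero>\<^bsub>T\<^esub>" if "x \<in> Gen" for x
      using that by (auto simp: Gen_def)
    then have "Gen \<subseteq> {v \<in> carrier (rmod X). p v = \<zero>\<^bsub>T\<^esub>}"
      using Gen by auto
    then show ?thesis
      unfolding N_def coequalizing_submodule_def Gen_def
      by (rule generated_least[OF is_submodule_kernel[OF X'(2) T p]])
  qed
  have b_ker: "N \<subseteq> {v \<in> carrier (rmod X). bmap X u v = \<zero>\<^bsub>W'\<^esub>}" if u: "u \<in> U" for u
  proof (rule N_ker[OF W_right X'(3)])
    show uX: "u \<in> carrier (LMod X)" using u U_sub by auto
    fix Y f g v assume EY: "(Y, f, g) \<in> E" and v: "v \<in> carrier (RMod Y)"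
    have "fst f u = fst g u" using u EY by (auto simp: U_def equalizer_set_def)
    then show "bmap X u (snd f v) = bmap X u (snd g v)"
      using E[OF EY] Hom_D(3)[of f X Y u v] Hom_D(3)[of g X Y u v] uX v by simp
  qed
  have Q_sub: "carrier (quotient_module (rmod X) N) \<subseteq> carrier (RMod X)"
    using carrier_quotient_subset[OF X'(2) N] by simp
  have K: "K \<in> Obj A"
    unfolding Adj_simps is_bimap_iff K_simps
  proof (intro conjI ballI)
    show "left_module R (LMod X\<lparr>carrier := U\<rparr>)"
      by (rule left_module_submodule[OF X'(1) U])
    show "left_module S' (left_of (right_of (quotient_module (rmod X) N)))"
      using left_module_quotient(1)[OF X'(2) N] by simp
    show "carrier (LMod X\<lparr>carrier := U\<rparr>) \<in> \<U>" "carrier (right_of (quotient_module (rmod X) N)) \<in> \<U>"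
      using universe X'(5,6) U_sub Q_sub by (auto simp: set_universe_def)
  next
    fix u assume "u \<in> carrier (LMod X\<lparr>carrier := U\<rparr>)"
    then have u: "u \<in> U" by simp
    then show "is_linear S' (left_of (right_of (quotient_module (rmod X) N))) W' (bmap X u)"
      using is_linear_from_quotient[OF X'(2) N W_right X'(3) b_ker[OF u]] U_sub by auto
  next
    fix v assume "v \<in> carrier (right_of (quotient_module (rmod X) N))"
    then show "is_linear R (LMod X\<lparr>carrier := U\<rparr>) W (\<lambda>u. bmap X u v)"
      using Q_sub by (intro is_linear_submodule[OF X'(4) U_sub]) auto
  qed
  have k: "k \<in> Hom A K X"
  proof -
    have "(restrict (\<lambda>u. u) (carrier (LMod K)), restrict (coset_rep (rmod X) N) (carrier (RMod X))) \<in> Hom A K X"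
    proof (rule Hom_restrictI[OF K X])
      show "is_linear R (LMod K) (LMod X) (\<lambda>u. u)"
        unfolding K_simps by (rule is_linear_submodule[OF _ U_sub]) (auto intro: is_linearI)
      show "is_linear S' (rmod X) (rmod K) (coset_rep (rmod X) N)"
        unfolding K_simps using left_module_quotient(2)[OF X'(2) N] by simp
      fix u v assume "u \<in> carrier (LMod K)" "v \<in> carrier (RMod X)"
      then show "bmap X u v = bmap K u (coset_rep (rmod X) N v)"
        using linear_coset_rep[OF X'(2) N W_right X'(3) b_ker, of u v] U_sub by (auto simp: K_simps)
    qed
    also have "(restrict (\<lambda>u. u) (carrier (LMod K)), restrict (coset_rep (rmod X) N) (carrier (RMod X))) = k"
      by (simp add: K_simps k_simps prod_eq_iff)
    finally show ?thesis .
  qed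
  have "Comp A K X Y k f = Comp A K X Y k g" if EY: "(Y, f, g) \<in> E" for Y f g
  proof -
    have f: "f \<in> Hom A X Y" and g: "g \<in> Hom A X Y" and Y: "Y \<in> Obj A" using E[OF EY] by auto
    have "fst f (fst k u) = fst g (fst k u)" if "u \<in> carrier (LMod K)" for u
      using that EY by (auto simp: K_simps k_simps U_def equalizer_set_def)
    moreover have "snd k (snd f v) = snd k (snd g v)" if v: "v \<in> carrier (RMod Y)" for v
    proof -
      have c: "snd f v \<in> carrier (rmod X)" "snd g v \<in> carrier (rmod X)"
        using Hom_D(5)[OF f v] Hom_D(5)[OF g v] by auto
      have "snd f v \<ominus>\<^bsub>rmod X\<^esub> snd g v \<in> N"
        by (rule subsetD[OF N_incl]) (use EY v in \<open>unfold Gen_def, blast\<close>)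
      then show ?thesis
        using c by (simp add: k_simps coset_rep_eq_iff[OF X'(2) N])
    qed
    ultimately show ?thesis by (simp add: Adj_simps(4) cong: restrict_cong)
  qed
  moreover have "\<exists>!h. h \<in> Hom A Z K \<and> Comp A Z K X h k = t"
    if Z: "Z \<in> Obj A" and t: "t \<in> Hom A Z X"
      and eq: "\<And>Y f g. (Y, f, g) \<in> E \<Longrightarrow> Comp A Z X Y t f = Comp A Z X Y t g" for Z t
  proof -
    have eq1: "fst f (fst t u) = fst g (fst t u)" if "(Y, f, g) \<in> E" "u \<in> carrier (LMod Z)" for Y f g u
      using eq[OF that(1)] that(2) by (auto simp: Adj_simps(4) fun_eq_iff split: if_splits)
    have eq2: "snd t (snd f v) = snd t (snd g v)" if "(Y, f, g) \<in> E" "v \<in> carrier (RMod Y)" for Y f g v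
      using eq[OF that(1)] that(2) by (auto simp: Adj_simps(4) fun_eq_iff split: if_splits)
    have tU: "fst t u \<in> U" if "u \<in> carrier (LMod Z)" for u
      using that eq1 Hom_D(4)[OF t that] by (auto simp: U_def equalizer_set_def)
    note Z' = Obj_D[OF Z]
    have t_ker: "N \<subseteq> {v \<in> carrier (rmod X). snd t v = \<zero>\<^bsub>rmod Z\<^esub>}"
      by (rule N_ker[OF Z'(2) Hom_D(2)[OF t] eq2])
    define h where "h = (restrict (fst t) (carrier (LMod Z)), restrict (snd t) (carrier (RMod K)))"
    have h: "h \<in> Hom A Z K"
      unfolding h_def
    proof (rule Hom_restrictI[OF Z K])
      show "is_linear R (LMod Z) (LMod K) (fst t)"
        using Hom_D(1)[OF t] tU by (auto simp: K_simps is_linear_def)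
      show "is_linear S' (rmod K) (rmod Z) (snd t)"
        using is_linear_from_quotient[OF X'(2) N Z'(2) Hom_D(2)[OF t] t_ker] by (simp add: K_simps)
      fix u v assume "u \<in> carrier (LMod Z)" "v \<in> carrier (RMod K)"
      then show "bmap K (fst t u) v = bmap Z u (snd t v)"
        using Q_sub by (auto simp: K_simps intro: Hom_D(3)[OF t])
    qed
    have hk: "Comp A Z K X h k = t"
      unfolding Comp_eq_iff[OF t]
      using linear_coset_rep[OF X'(2) N Z'(2) Hom_D(2)[OF t] t_ker] tU
      by (auto simp: h_def k_simps K_simps carrier_quotient_module)
    show ?thesis
    proof (rule ex1I[of _ h])
      show "h \<in> Hom A Z K \<and> Comp A Z K X h k = t" using h hk by simp
      fix h' assume h': "h' \<in> Hom A Z K \<and> Comp A Z K X h' k = t"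
      then have c: "\<And>u. u \<in> carrier (LMod Z) \<Longrightarrow> fst k (fst h' u) = fst k (fst h u)"
          "\<And>v. v \<in> carrier (RMod X) \<Longrightarrow> snd h' (snd k v) = snd h (snd k v)"
        using hk unfolding Comp_eq_iff[OF t] by auto
      show "h' = h"
      proof (rule Hom_eqI)
        fix u assume u: "u \<in> carrier (LMod Z)"
        then show "fst h' u = fst h u"
          using c(1)[OF u] Hom_D(4)[OF h u] Hom_D(4)[of h' Z K u] h' by (simp add: k_simps K_simps)
      next
        fix v assume "v \<in> carrier (RMod K)"
        then obtain x where "x \<in> carrier (RMod X)" "v = snd k x"
          by (auto simp: K_simps k_simps carrier_quotient_module)
        then show "snd h' v = snd h v" using c(2) by simp
      qed (use h h' in auto)
    qed
  qed
  ultimately show ?thesis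
    using K k unfolding is_joint_equalizer_def K_def k_def by blast
qed

section \<open>Monomorphisms and epimorphisms in the adjoint category\<close>

text \<open>
  The kernel of \<open>f\<close> has the left component \<open>ker f\<close>, and its right component is the quotient by the
  image of \<open>f\<close>.  The last two claims give just what is needed to recover injectivity and
  surjectivity of the components of \<open>f\<close>.
\<close>

lemma kernel_components:
  assumes X: "X \<in> Obj A" and Y: "Y \<in> Obj A" and f: "f \<in> Hom A X Y"
  defines "K \<equiv> equalizer_object X {(Y, f, HZero A X Y)}" and "k \<equiv> equalizer_map X {(Y, f, HZero A X Y)}"
  shows "is_kernel A X Y f K k"
    and "\<And>u. u \<in> carrier (LMod X) \<Longrightarrow> fst f u = \<zero>\<^bsub>LMod Y\<^esub> \<Longrightarrow> u \<in> carrier (LMod K) \<and> fst k u = u"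
    and "\<And>v. v \<in> carrier (RMod X) \<Longrightarrow> snd k v = \<zero>\<^bsub>RMod K\<^esub> \<Longrightarrow> v \<in> snd f ` carrier (RMod Y)"
proof -
  let ?E = "{(Y, f, HZero A X Y)}" and ?N = "coequalizing_submodule X {(Y, f, HZero A X Y)}"
  note X' = Obj_D[OF X] and Y' = Obj_D[OF Y]
  interpret XR: left_module S' "rmod X" by (rule X')
  have "is_joint_equalizer A X ?E K k"
    unfolding K_def k_def using X Y f HZero_in_Hom[OF X Y] by (intro joint_equalizer) auto
  then show "is_kernel A X Y f K k"
    by (rule kernel_if_joint_equalizer[OF X Y])
  show "u \<in> carrier (LMod K) \<and> fst k u = u"
    if "u \<in> carrier (LMod X)" "fst f u = \<zero>\<^bsub>LMod Y\<^esub>" for u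
    using that by (simp add: K_def k_def equalizer_object_def equalizer_map_def equalizer_set_def Adj_simps(6))
  have N: "is_submodule S' (rmod X) ?N"
    unfolding coequalizing_submodule_def by (rule is_submodule_generated[OF X'(2)])
  have "?N \<subseteq> snd f ` carrier (rmod Y)"
    unfolding coequalizing_submodule_def
  proof (rule generated_least[OF is_submodule_image[OF Y'(2) X'(2) Hom_D(2)[OF f]]])
    have "snd f v \<ominus>\<^bsub>rmod X\<^esub> \<zero>\<^bsub>RMod X\<^esub> = snd f v" if "v \<in> carrier (RMod Y)" for v
      using left_module_minus_zero[OF X'(2), of "snd f v"] Hom_D(5)[OF f that] by simp
    then show "{snd f' v \<ominus>\<^bsub>rmod X\<^esub> snd g v |Y' f' g v. (Y', f', g) \<in> ?E \<and> v \<in> carrier (RMod Y')}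
        \<subseteq> snd f ` carrier (rmod Y)"
      by (auto simp: Adj_simps(6))
  qed
  moreover have "v \<in> ?N" if "v \<in> carrier (RMod X)" "snd k v = \<zero>\<^bsub>RMod K\<^esub>" for v
  proof -
    have "coset_rep (rmod X) ?N v = coset_rep (rmod X) ?N \<zero>\<^bsub>rmod X\<^esub>"
      using that by (simp add: K_def k_def equalizer_object_def equalizer_map_def quotient_module_def)
    then have "v \<ominus>\<^bsub>rmod X\<^esub> \<zero>\<^bsub>rmod X\<^esub> \<in> ?N"
      using that coset_rep_eq_iff[OF X'(2) N, of v "\<zero>\<^bsub>rmod X\<^esub>"] left_module_closed(1)[OF X'(2)] by simp
    then show ?thesis
      using that left_module_minus_zero[OF X'(2), of v] by simp
  qed
  ultimately show "v \<in> snd f ` carrier (RMod Y)"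
    if "v \<in> carrier (RMod X)" "snd k v = \<zero>\<^bsub>RMod K\<^esub>" for v
    using that by auto
qed

text \<open>A monomorphism has a zero kernel morphism, and the claims are read off its two components.\<close>

lemma mono_components:
  assumes X: "X \<in> Obj A" and Y: "Y \<in> Obj A" and mono: "is_mono A X Y f"
  shows "inj_on (fst f) (carrier (LMod X))" "snd f ` carrier (RMod Y) = carrier (RMod X)"
proof -
  have f: "f \<in> Hom A X Y" using mono by (simp add: is_mono_def)
  note X' = Obj_D[OF X] and Y' = Obj_D[OF Y]
  interpret XL: left_module R "LMod X" by (rule X')
  interpret YL: left_module R "LMod Y" by (rule Y')
  define K k where "K = equalizer_object X {(Y, f, HZero A X Y)}" and "k = equalizer_map X {(Y, f, HZero A X Y)}"
  note Kk = kernel_components[OF X Y f, folded K_def k_def]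
  have K: "K \<in> Obj A" and k: "k \<in> Hom A K X" and kf: "Comp A K X Y k f = HZero A K Y"
    using Kk(1) by (auto simp: is_kernel_def)
  have k0: "k = HZero A K X"
    using mono K k kf HZero_in_Hom[OF K X] Comp_HZero_left[OF K X Y f] by (auto simp: is_mono_def)
  show "inj_on (fst f) (carrier (LMod X))"
  proof (rule inj_onI)
    fix u u' assume u: "u \<in> carrier (LMod X)" "u' \<in> carrier (LMod X)" "fst f u = fst f u'"
    then have "fst f (u \<ominus>\<^bsub>LMod X\<^esub> u') = \<zero>\<^bsub>LMod Y\<^esub>"
      using is_linear_minus[OF X'(1) Y'(1) Hom_D(1)[OF f]] Hom_D(4)[OF f]
      by (simp add: a_minus_def YL.M.r_neg)
    then have "u \<ominus>\<^bsub>LMod X\<^esub> u' \<in> carrier (LMod K)" "fst k (u \<ominus>\<^bsub>LMod X\<^esub> u') = u \<ominus>\<^bsub>LMod X\<^esub> u'"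
      using Kk(2) u by auto
    then have "u \<ominus>\<^bsub>LMod X\<^esub> u' = \<zero>\<^bsub>LMod X\<^esub>"
      by (simp add: k0 Adj_simps(6))
    then show "u = u'"
      using u left_module_minus_eq_zero_iff[OF X'(1)] by simp
  qed
  have "v \<in> snd f ` carrier (RMod Y)" if "v \<in> carrier (RMod X)" for v
    using that by (intro Kk(3)) (simp_all add: k0 Adj_simps(6))
  then show "snd f ` carrier (RMod Y) = carrier (RMod X)"
    using Hom_D(5)[OF f] by auto
qed

text \<open>
  A morphism \<open>g\<close> that is killed by the kernel of \<open>f\<close> vanishes on the left kernel of \<open>f\<close> and takes its
  right values in the image of \<open>f\<close>.  So its left component factors through the surjection and its
  right component lifts through the injection that \<open>f\<close> provides.
\<close>

lemma surj_inj_is_cokernel: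
  assumes X: "X \<in> Obj A" and Y: "Y \<in> Obj A" and f: "f \<in> Hom A X Y"
    and surj: "fst f ` carrier (LMod X) = carrier (LMod Y)" and inj: "inj_on (snd f) (carrier (RMod Y))"
  shows "\<exists>Z \<in> Obj A. \<exists>g \<in> Hom A Z X. is_cokernel A Z X g Y f"
proof -
  note X' = Obj_D[OF X] and Y' = Obj_D[OF Y]
  interpret XL: left_module R "LMod X" by (rule X')
  interpret YL: left_module R "LMod Y" by (rule Y')
  define K k where "K = equalizer_object X {(Y, f, HZero A X Y)}" and "k = equalizer_map X {(Y, f, HZero A X Y)}"
  note Kk = kernel_components[OF X Y f, folded K_def k_def]
  have K: "K \<in> Obj A" and k: "k \<in> Hom A K X" and kf: "Comp A K X Y k f = HZero A K Y"
    using Kk(1) by (auto simp: is_kernel_def)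
  have "\<exists>!h. h \<in> Hom A Y Z \<and> Comp A X Y Z f h = g"
    if Z: "Z \<in> Obj A" and g: "g \<in> Hom A X Z" and kg: "Comp A K X Z k g = HZero A K Z" for Z g
  proof -
    note Z' = Obj_D[OF Z]
    interpret ZL: left_module R "LMod Z" by (rule Z')
    have kg1: "fst g (fst k u) = \<zero>\<^bsub>LMod Z\<^esub>" if "u \<in> carrier (LMod K)" for u
      using fun_cong[OF arg_cong[OF kg, of fst], of u] that by (simp add: Adj_simps(4,6))
    have kg2: "snd k (snd g v) = \<zero>\<^bsub>RMod K\<^esub>" if "v \<in> carrier (RMod Z)" for v
      using fun_cong[OF arg_cong[OF kg, of snd], of v] that by (simp add: Adj_simps(4,6))
    have cong: "fst g x = fst g y"
      if xy: "x \<in> carrier (LMod X)" "y \<in> carrier (LMod X)" "fst f x = fst f y" for x y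
    proof -
      have "fst f (x \<ominus>\<^bsub>LMod X\<^esub> y) = \<zero>\<^bsub>LMod Y\<^esub>"
        using is_linear_minus[OF X'(1) Y'(1) Hom_D(1)[OF f]] Hom_D(4)[OF f] xy
        by (simp add: left_module_minus_eq_zero_iff[OF Y'(1)])
      then have "fst g (x \<ominus>\<^bsub>LMod X\<^esub> y) = \<zero>\<^bsub>LMod Z\<^esub>"
        using Kk(2)[of "x \<ominus>\<^bsub>LMod X\<^esub> y"] kg1[of "x \<ominus>\<^bsub>LMod X\<^esub> y"] xy by auto
      then have "fst g x \<ominus>\<^bsub>LMod Z\<^esub> fst g y = \<zero>\<^bsub>LMod Z\<^esub>"
        using is_linear_minus[OF X'(1) Z'(1) Hom_D(1)[OF g]] xy by simp
      then show ?thesis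
        using xy Hom_D(4)[OF g] left_module_minus_eq_zero_iff[OF Z'(1)] by simp
    qed
    obtain p where p: "is_linear R (LMod Y) (LMod Z) p"
      "\<And>x. x \<in> carrier (LMod X) \<Longrightarrow> p (fst f x) = fst g x"
      using linear_factor_through_surjection[OF X'(1) Y'(1) Hom_D(1)[OF f] surj Hom_D(1)[OF g] cong] by blast
    have im: "snd g v \<in> snd f ` carrier (rmod Y)" if "v \<in> carrier (rmod Z)" for v
      using Kk(3)[OF Hom_D(5)[OF g] kg2] that by simp
    have inj': "inj_on (snd f) (carrier (rmod Y))" using inj by simp
    obtain q where q: "is_linear S' (rmod Z) (rmod Y) q"
      "\<And>v. v \<in> carrier (rmod Z) \<Longrightarrow> snd f (q v) = snd g v"
      using linear_lift_through_injection[OF Y'(2) X'(2) Z'(2) Hom_D(2)[OF f] inj' Hom_D(2)[OF g] im] by blast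
    define h where "h = (restrict p (carrier (LMod Y)), restrict q (carrier (RMod Z)))"
    have h: "h \<in> Hom A Y Z"
      unfolding h_def
    proof (rule Hom_restrictI[OF Y Z p(1) q(1)])
      fix y v assume y: "y \<in> carrier (LMod Y)" and v: "v \<in> carrier (RMod Z)"
      obtain x where x: "x \<in> carrier (LMod X)" "y = fst f x" using y surj by auto
      have "bmap Z (p y) v = bmap X x (snd f (q v))"
        using x v p(2) q(2) Hom_D(3)[OF g x(1) v] by simp
      also have "\<dots> = bmap Y y (q v)"
        using Hom_D(3)[OF f x(1)] is_linearD(1)[OF q(1), of v] v x by simp
      finally show "bmap Z (p y) v = bmap Y y (q v)" .
    qed
    have fh: "Comp A X Y Z f h = g"
      unfolding Comp_eq_iff[OF g] using p(2) q(2) Hom_D(4)[OF f] by (auto simp: h_def)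
    show ?thesis
    proof (rule ex1I[of _ h])
      show "h \<in> Hom A Y Z \<and> Comp A X Y Z f h = g" using h fh by simp
      fix h' assume h': "h' \<in> Hom A Y Z \<and> Comp A X Y Z f h' = g"
      then have c: "\<And>u. u \<in> carrier (LMod X) \<Longrightarrow> fst h' (fst f u) = fst h (fst f u)"
          "\<And>v. v \<in> carrier (RMod Z) \<Longrightarrow> snd f (snd h' v) = snd f (snd h v)"
        using fh unfolding Comp_eq_iff[OF g] by auto
      show "h' = h"
      proof (rule Hom_eqI)
        fix u assume "u \<in> carrier (LMod Y)"
        then obtain x where "x \<in> carrier (LMod X)" "u = fst f x" using surj by auto
        then show "fst h' u = fst h u" using c(1) by simp
      next
        fix v assume v: "v \<in> carrier (RMod Z)"
        then show "snd h' v = snd h v"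
          using inj_onD[OF inj c(2)[OF v]] Hom_D(5)[OF h v] Hom_D(5)[of h' Y Z v] h' by blast
      qed (use h h' in auto)
    qed
  qed
  then have "is_cokernel A K X k Y f"
    unfolding is_cokernel_def using Y f kf by blast
  then show ?thesis using K k by blast
qed

end


section \<open>Products in the adjoint category\<close>

lemma small_index_inj:
  assumes "small_index \<U> I" "\<And>i. i \<in> I \<Longrightarrow> M i \<in> \<U>"
  obtains P e where "P \<in> \<U>" "inj_on e (\<Pi>\<^sub>E i \<in> I. M i)" "e ` (\<Pi>\<^sub>E i \<in> I. M i) = P"
proof -
  obtain P where P: "P \<in> \<U>" "P \<approx> (\<Pi>\<^sub>E i \<in> I. M i)"
    using assms unfolding small_index_def by blast
  then obtain e where "bij_betw e (\<Pi>\<^sub>E i \<in> I. M i) P"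
    using eqpoll_sym unfolding eqpoll_def by blast
  then show ?thesis using P that by (auto simp: bij_betw_def)
qed

lemma small_index_empty:
  assumes "set_universe \<U>"
  shows "small_index \<U> ({} :: 'i set)"
proof -
  obtain M a where M: "M \<in> \<U>" "a \<in> M" using assms by (auto simp: set_universe_def)
  have "{a} \<in> \<U>" using assms M by (auto simp: set_universe_def)
  moreover have "{a} \<approx> {\<lambda>x. undefined}" by (rule singleton_eqpoll)
  ultimately show ?thesis by (auto simp: small_index_def)
qed

lemma small_index_bool:
  assumes "set_universe \<U>"
  shows "small_index \<U> (UNIV :: bool set)"
  unfolding small_index_def
proof (intro allI impI)
  fix M :: "bool \<Rightarrow> _" assume "\<forall>i \<in> UNIV. M i \<in> \<U>"
  then obtain P where P: "P \<in> \<U>" "P \<approx> M True \<times> M False"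
    using assms unfolding set_universe_def by blast
  have "bij_betw (\<lambda>x. (x True, x False)) (\<Pi>\<^sub>E i \<in> UNIV. M i) (M True \<times> M False)"
    by (rule bij_betwI[where g = "\<lambda>(a, b) i. if i then a else b"]) (auto simp: fun_eq_iff all_bool_eq)
  then have "(\<Pi>\<^sub>E i \<in> UNIV. M i) \<approx> M True \<times> M False" by (auto simp: eqpoll_def)
  then show "\<exists>P \<in> \<U>. P \<approx> (\<Pi>\<^sub>E i \<in> UNIV. M i)"
    using P eqpoll_trans eqpoll_sym by blast
qed

context adjoint_category
begin

lemma finsum_W': "finsum W' f I = finsum W f I"
  by (simp add: finsum_def finprod_def)

text \<open>
  Morphisms \<open>Y \<rightarrow> X\<^sub>i\<close> combine to a map from the left module of \<open>Y\<close> into the product and to a map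
  from the direct sum into the right module of \<open>Y\<close>.  They are adjoint because both sides of the
  adjointness condition are linear on the direct sum and agree on each summand.  The bijections
  \<open>e\<close> and \<open>d\<close> below move product and direct sum to carriers in the universe.
\<close>

lemma product_exists:
  fixes X :: "'i \<Rightarrow> ('r, 's, 'm, 'w) bimap"
  assumes small: "small_index \<U> I" and X: "\<And>i. i \<in> I \<Longrightarrow> X i \<in> Obj A"
  shows "\<exists>P \<pi>. is_product A I X P \<pi>"
proof -
  note X' = Obj_D[OF X]
  define LM where "LM = (\<lambda>i. LMod (X i))"
  define RM where "RM = (\<lambda>i. rmod (X i))"
  define U where "U = product_module I LM"
  define V where "V = direct_sum I RM"
  have LM: "left_module R (LM i)" if "i \<in> I" for i using X'(1)[OF that] by (simp add: LM_def)
  have RM: "left_module S' (RM i)" if "i \<in> I" for i using X'(2)[OF that] by (simp add: RM_def)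
  have U: "left_module R U" unfolding U_def by (rule left_module_product[OF ring_R LM])
  have V: "left_module S' V" unfolding V_def by (rule left_module_direct_sum[OF ring_S' RM])
  interpret V: left_module S' V by (rule V)
  have U_car: "carrier U = (\<Pi>\<^sub>E i \<in> I. carrier (LMod (X i)))" by (simp add: U_def LM_def)
  have V_car: "carrier V = finite_supports I RM" by (simp add: V_def)
  have V_sub: "carrier V \<subseteq> (\<Pi>\<^sub>E i \<in> I. carrier (RMod (X i)))"
    by (auto simp: V_car RM_def finite_supports_def)
  have U_i: "x i \<in> carrier (LMod (X i))" if "x \<in> carrier U" "i \<in> I" for x i
    using that by (auto simp: U_car)
  have V_i: "y i \<in> carrier (RMod (X i))" if "y \<in> carrier V" "i \<in> I" for y i
    using that V_sub by auto
  obtain P e where P: "P \<in> \<U>" and e: "inj_on e (carrier U)" and eP: "e ` carrier U = P"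
    using small_index_inj[OF small, of "\<lambda>i. carrier (LMod (X i))"] X'(5) by (auto simp: U_car)
  obtain P' d where P': "P' \<in> \<U>" and d0: "inj_on d (\<Pi>\<^sub>E i \<in> I. carrier (RMod (X i)))"
    and dP': "d ` (\<Pi>\<^sub>E i \<in> I. carrier (RMod (X i))) = P'"
    using small_index_inj[OF small, of "\<lambda>i. carrier (RMod (X i))"] X'(6) by auto
  have d: "inj_on d (carrier V)" using d0 V_sub by (rule inj_on_subset)
  have dU: "d ` carrier V \<in> \<U>"
    using universe P' dP' image_mono[OF V_sub, of d] by (auto simp: set_universe_def)
  define e' where "e' = inv_into (carrier U) e"
  define d' where "d' = inv_into (carrier V) d"
  have e': "e' (e x) = x" if "x \<in> carrier U" for x using e that by (simp add: e'_def)
  have d': "d' (d y) = y" if "y \<in> carrier V" for y using d that by (simp add: d'_def)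
  note e_lin = left_module_transport[OF U e] and d_lin = left_module_transport[OF V d]
  note e'_lin = is_linear_inv_transport[OF U e, folded e'_def]
  note d'_lin = is_linear_inv_transport[OF V d, folded d'_def]
  note inc_lin = is_linear_summand_incl[of I S' RM, OF RM, folded V_def]
  have inc: "summand_incl I RM i v \<in> carrier V" if "i \<in> I" "v \<in> carrier (RMod (X i))" for i v
    using is_linearD(1)[OF inc_lin[OF _ that(1)]] that by (simp add: RM_def)

  define \<beta> where "\<beta> x = sum_map W' I RM (\<lambda>i. bmap (X i) (x i))" for x
  have b_lin: "is_linear S' (RM i) W' (bmap (X i) (x i))" if "x \<in> carrier U" "i \<in> I" for x i
    unfolding RM_def using that by (intro X'(3) U_i) auto
  have \<beta>_lin: "is_linear S' V W' (\<beta> x)" if "x \<in> carrier U" for x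
    unfolding \<beta>_def V_def using b_lin[OF that] by (intro is_linear_sum_map ring_S' RM W_right) auto
  have \<beta>_lin': "is_linear R U W (\<lambda>x. \<beta> x y)" if y: "y \<in> carrier V" for y
    unfolding \<beta>_def sum_map_def finsum_W'
  proof (rule is_linear_finsum_of_maps[OF W_left _ U])
    fix i assume "i \<in> {i \<in> I. y i \<noteq> \<zero>\<^bsub>RM i\<^esub>}"
    then have i: "i \<in> I" by auto
    have "is_linear R U (LM i) (\<lambda>x. x i)" unfolding U_def by (rule is_linear_projection[OF i])
    then show "is_linear R U W (\<lambda>x. bmap (X i) (x i) (y i))"
      using X'(4)[OF i V_i[OF y i]] unfolding LM_def by (rule is_linear_comp)
  qed
  have \<beta>_inc: "\<beta> x (summand_incl I RM i v) = bmap (X i) (x i) v"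
    if "x \<in> carrier U" "i \<in> I" "v \<in> carrier (RMod (X i))" for x i v
    unfolding \<beta>_def using that b_lin[OF that(1)]
    by (intro sum_map_summand_incl[where R = S'] RM W_right) (auto simp: RM_def)

  (* e' and d' undo the transport: elements of Q are read as families again. *)
  define Q :: "('r, 's, 'm, 'w) bimap" where
    "Q = \<lparr>LMod = image_module U e, RMod = right_of (image_module V d), bmap = (\<lambda>a b. \<beta> (e' a) (d' b))\<rparr>"
  have Q_simps: "LMod Q = image_module U e" "RMod Q = right_of (image_module V d)"
    "bmap Q a b = \<beta> (e' a) (d' b)" for a b
    by (simp_all add: Q_def)
  have Q: "Q \<in> Obj A"
    unfolding Adj_simps is_bimap_iff
  proof (intro conjI ballI)
    show "left_module R (LMod Q)" "left_module S' (rmod Q)"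
      using e_lin(1) d_lin(1) by (simp_all add: Q_simps)
    show "carrier (LMod Q) \<in> \<U>" "carrier (RMod Q) \<in> \<U>"
      using P eP dU by (simp_all add: Q_simps)
  next
    fix a assume "a \<in> carrier (LMod Q)"
    then have "e' a \<in> carrier U" by (auto simp: Q_simps e')
    from is_linear_comp[OF d'_lin \<beta>_lin[OF this]] show "is_linear S' (rmod Q) W' (bmap Q a)"
      by (simp add: Q_def)
  next
    fix b assume "b \<in> carrier (RMod Q)"
    then have "d' b \<in> carrier V" by (auto simp: Q_simps d')
    from is_linear_comp[OF e'_lin \<beta>_lin'[OF this]] show "is_linear R (LMod Q) W (\<lambda>a. bmap Q a b)"
      by (simp add: Q_simps)
  qed
  define \<pi> where "\<pi> i = (\<lambda>a \<in> carrier (LMod Q). e' a i,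
    \<lambda>v \<in> carrier (RMod (X i)). d (summand_incl I RM i v))" for i
  have pi: "\<pi> i \<in> Hom A Q (X i)" if i: "i \<in> I" for i
    unfolding \<pi>_def
  proof (rule Hom_restrictI[OF Q X[OF i]])
    show "is_linear R (LMod Q) (LMod (X i)) (\<lambda>a. e' a i)"
      using is_linear_comp[OF e'_lin is_linear_projection[OF i, of R LM, folded U_def]]
      by (simp add: Q_simps LM_def)
    show "is_linear S' (rmod (X i)) (rmod Q) (\<lambda>v. d (summand_incl I RM i v))"
      using is_linear_comp[OF inc_lin[OF _ i] d_lin(2)] by (simp add: Q_simps RM_def)
    fix a v assume "a \<in> carrier (LMod Q)" "v \<in> carrier (RMod (X i))"
    then show "bmap (X i) (e' a i) v = bmap Q a (d (summand_incl I RM i v))"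
      using i by (auto simp: Q_simps e' d' inc \<beta>_inc)
  qed
  have "\<exists>!h. h \<in> Hom A Y Q \<and> (\<forall>i \<in> I. Comp A Y Q (X i) h (\<pi> i) = \<rho> i)"
    if Y: "Y \<in> Obj A" and rho: "\<And>i. i \<in> I \<Longrightarrow> \<rho> i \<in> Hom A Y (X i)" for Y \<rho>
  proof -
    note Y' = Obj_D[OF Y] and rho' = Hom_D[OF rho]
    define p where "p z = (\<lambda>i \<in> I. fst (\<rho> i) z)" for z
    define q where "q = sum_map (rmod Y) I RM (\<lambda>i. snd (\<rho> i))"
    have p: "is_linear R (LMod Y) U p"
      unfolding p_def U_def using rho'(1) by (intro is_linear_into_product) (auto simp: LM_def)
    have rho_lin: "is_linear S' (RM i) (rmod Y) (snd (\<rho> i))" if "i \<in> I" for i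
      using rho'(2)[OF that] by (simp add: RM_def)
    have q: "is_linear S' V (rmod Y) q"
      unfolding q_def V_def by (rule is_linear_sum_map[OF ring_S' RM Y'(2) rho_lin])
    have q_inc: "q (summand_incl I RM i v) = snd (\<rho> i) v" if "i \<in> I" "v \<in> carrier (RMod (X i))" for i v
      unfolding q_def using that
      by (intro sum_map_summand_incl[where R = S'] RM Y' rho_lin) (auto simp: RM_def)
    have p_car: "p z \<in> carrier U" if "z \<in> carrier (LMod Y)" for z using is_linearD(1)[OF p that] .
    have adj: "\<beta> (p z) y = bmap Y z (q y)" if z: "z \<in> carrier (LMod Y)" and y: "y \<in> carrier V" for z y
    proof -
      have lin: "is_linear S' (direct_sum I RM) W' (\<beta> (p z))"
        "is_linear S' (direct_sum I RM) W' (\<lambda>y. bmap Y z (q y))"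
        using \<beta>_lin[OF p_car[OF z]] is_linear_comp[OF q Y'(3)[OF z]] by (simp_all add: V_def)
      have "\<beta> (p z) (summand_incl I RM i v) = bmap Y z (q (summand_incl I RM i v))"
        if "i \<in> I" "v \<in> carrier (RM i)" for i v
        using that rho'(3)[OF that(1) z, of v] \<beta>_inc[OF p_car[OF z] that(1), of v] q_inc
        by (simp add: RM_def p_def)
      then show ?thesis
        using linear_eq_on_direct_sum[OF ring_S' RM W_right lin] y by (simp add: V_car)
    qed
    define h where "h = (restrict (\<lambda>z. e (p z)) (carrier (LMod Y)), restrict (\<lambda>b. q (d' b)) (carrier (RMod Q)))"
    have h: "h \<in> Hom A Y Q"
      unfolding h_def
    proof (rule Hom_restrictI[OF Y Q])
      show "is_linear R (LMod Y) (LMod Q) (\<lambda>z. e (p z))"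
        using is_linear_comp[OF p e_lin(2)] by (simp add: Q_simps)
      show "is_linear S' (rmod Q) (rmod Y) (\<lambda>b. q (d' b))"
        using is_linear_comp[OF d'_lin q] by (simp add: Q_simps)
      fix z b assume "z \<in> carrier (LMod Y)" "b \<in> carrier (RMod Q)"
      then show "bmap Q (e (p z)) b = bmap Y z (q (d' b))"
        by (auto simp: Q_simps e' d' p_car adj)
    qed
    have comp_iff: "Comp A Y Q (X i) h' (\<pi> i) = \<rho> i \<longleftrightarrow>
      (\<forall>z \<in> carrier (LMod Y). e' (fst h' z) i = fst (\<rho> i) z) \<and>
      (\<forall>v \<in> carrier (RMod (X i)). snd h' (d (summand_incl I RM i v)) = snd (\<rho> i) v)"
      if "i \<in> I" "h' \<in> Hom A Y Q" for i h'
      unfolding Comp_eq_iff[OF rho[OF that(1)]] using Hom_D(4)[OF that(2)] by (simp add: \<pi>_def)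
    have hpi: "Comp A Y Q (X i) h (\<pi> i) = \<rho> i" if i: "i \<in> I" for i
      unfolding comp_iff[OF i h] using i by (auto simp: h_def e' d' p_car inc Q_simps q_inc) (simp add: p_def)
    show ?thesis
    proof (rule ex1I[of _ h])
      show "h \<in> Hom A Y Q \<and> (\<forall>i \<in> I. Comp A Y Q (X i) h (\<pi> i) = \<rho> i)" using h hpi by simp
      fix h' assume "h' \<in> Hom A Y Q \<and> (\<forall>i \<in> I. Comp A Y Q (X i) h' (\<pi> i) = \<rho> i)"
      then have h': "h' \<in> Hom A Y Q" and c1: "\<And>i z. i \<in> I \<Longrightarrow> z \<in> carrier (LMod Y) \<Longrightarrow> e' (fst h' z) i = fst (\<rho> i) z"
        and c2: "\<And>i v. i \<in> I \<Longrightarrow> v \<in> carrier (RMod (X i)) \<Longrightarrow> snd h' (d (summand_incl I RM i v)) = snd (\<rho> i) v"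
        using comp_iff by blast+
      show "h' = h"
      proof (rule Hom_eqI[OF h' h])
        fix z assume z: "z \<in> carrier (LMod Y)"
        obtain x where x: "x \<in> carrier U" "fst h' z = e x" using Hom_D(4)[OF h' z] by (auto simp: Q_simps)
        have "x = p z"
          using x c1[OF _ z] p_car[OF z] by (intro PiE_ext[of x I _ "p z"]) (auto simp: U_car e' p_def)
        then show "fst h' z = fst h z" using x z by (simp add: h_def)
      next
        fix b assume b: "b \<in> carrier (RMod Q)"
        then obtain y where y: "y \<in> carrier V" "b = d y" by (auto simp: Q_simps)
        have lin: "is_linear S' (direct_sum I RM) (rmod Y) (\<lambda>y. snd h' (d y))"
          using is_linear_comp[OF d_lin(2), of "rmod Y" "snd h'"] Hom_D(2)[OF h'] by (simp add: Q_simps V_def)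
        have "snd h' (d (summand_incl I RM i v)) = q (summand_incl I RM i v)"
          if "i \<in> I" "v \<in> carrier (RM i)" for i v
          using c2[OF that(1)] q_inc[OF that(1)] that(2) by (simp add: RM_def)
        then have "snd h' (d y) = q y"
          using linear_eq_on_direct_sum[OF ring_S' RM Y'(2) lin q[unfolded V_def]] y by (simp add: V_car)
        then show "snd h' b = snd h b" using b y by (simp add: h_def d')
      qed
    qed
  qed
  then have "is_product A I X Q \<pi>"
    unfolding is_product_def using Q pi by blast
  then show ?thesis by blast
qed

section \<open>The adjoint category is abelian, complete and cocomplete\<close>

lemma Adj_zero_object: "\<exists>Z. is_zero_object A Z"
proof -
  obtain T \<pi> where "is_product A {} (\<lambda>_ :: unit. undefined) T \<pi>"
    using product_exists[OF small_index_empty[OF universe], of "\<lambda>_ :: unit. undefined"] by blast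
  then show ?thesis using zero_object_if_empty_product by blast
qed

lemma Adj_biproducts:
  assumes "X \<in> Obj A" "Y \<in> Obj A"
  shows "\<exists>P \<iota>\<^sub>1 \<iota>\<^sub>2 \<pi>\<^sub>1 \<pi>\<^sub>2. is_biproduct A X Y P \<iota>\<^sub>1 \<iota>\<^sub>2 \<pi>\<^sub>1 \<pi>\<^sub>2"
proof -
  have "(if b then X else Y) \<in> Obj A" for b using assms by simp
  then obtain P \<pi> where "is_product A (UNIV :: bool set) (\<lambda>b. if b then X else Y) P \<pi>"
    using product_exists[OF small_index_bool[OF universe], of "\<lambda>b. if b then X else Y"] by blast
  then show ?thesis by (rule biproduct_if_product[OF assms])
qed

lemma Adj_limits:
  fixes J :: "('i, 'j) category"
  assumes J: "small_index \<U> (Obj J)" and F: "is_functor J A F\<^sub>0 F\<^sub>1"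
  shows "\<exists>X \<pi>. is_limit J A F\<^sub>0 F\<^sub>1 X \<pi>"
proof -
  have F0: "\<And>i. i \<in> Obj J \<Longrightarrow> F\<^sub>0 i \<in> Obj A"
    and F1: "\<And>i j f. \<lbrakk>i \<in> Obj J; j \<in> Obj J; f \<in> Hom J i j\<rbrakk> \<Longrightarrow> F\<^sub>1 i j f \<in> Hom A (F\<^sub>0 i) (F\<^sub>0 j)"
    using F by (auto simp: is_functor_def)
  obtain P \<pi> where P: "is_product A (Obj J) F\<^sub>0 P \<pi>"
    using product_exists[OF J, of F\<^sub>0] F0 by blast
  then have P': "P \<in> Obj A" "\<And>i. i \<in> Obj J \<Longrightarrow> \<pi> i \<in> Hom A P (F\<^sub>0 i)"
    by (auto simp: is_product_def)
  show ?thesis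
    using limit_if_product_and_joint_equalizer[OF F P joint_equalizer[OF P'(1)]]
    using F0 F1 P' by (blast intro: Comp_in_Hom)
qed

interpretation dual: adjoint_category S' "opposite_ring R" W' \<U>
  by unfold_locales (rule is_bimodule_opposite[OF bimodule], rule universe)

interpretation dual_iso: contravariant_iso A dual.A opposite_bimap opposite_bimap prod.swap prod.swap
  by (rule Adj_contravariant_iso)

lemma Adj_kernels:
  assumes "X \<in> Obj A" "Y \<in> Obj A" "f \<in> Hom A X Y"
  shows "\<exists>K k. is_kernel A X Y f K k"
  using kernel_components(1)[OF assms] by blast

text \<open>An epimorphism is a monomorphism of the dual category, where its components are swapped.\<close>

lemma Adj_epi_is_cokernel:
  assumes X: "X \<in> Obj A" and Y: "Y \<in> Obj A" and epi: "is_epi A X Y f"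
  shows "\<exists>Z \<in> Obj A. \<exists>g \<in> Hom A Z X. is_cokernel A Z X g Y f"
proof -
  have f: "f \<in> Hom A X Y" using epi by (simp add: is_epi_def)
  have "is_mono dual.A (opposite_bimap Y) (opposite_bimap X) (prod.swap f)"
    using epi by (simp add: dual_iso.is_mono_iff)
  then have "inj_on (snd f) (carrier (RMod Y))" "fst f ` carrier (LMod X) = carrier (LMod Y)"
    using dual.mono_components[of "opposite_bimap Y" "opposite_bimap X" "prod.swap f"] X Y
    by (simp_all add: dual_iso.Obj_iff)
  then show ?thesis by (intro surj_inj_is_cokernel X Y f)
qed

end

context adjoint_category
begin

interpretation dual: adjoint_category S' "opposite_ring R" W' \<U>
  by unfold_locales (rule is_bimodule_opposite[OF bimodule], rule universe)

interpretation dual_iso: contravariant_iso A dual.A opposite_bimap opposite_bimap prod.swap prod.swap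
  by (rule Adj_contravariant_iso)

lemma Adj_cokernels:
  assumes "X \<in> Obj A" "Y \<in> Obj A" "f \<in> Hom A X Y"
  shows "\<exists>Q q. is_cokernel A X Y f Q q"
proof -
  obtain K k where "is_kernel dual.A (opposite_bimap Y) (opposite_bimap X) (prod.swap f) K k"
    using dual.Adj_kernels[of "opposite_bimap Y" "opposite_bimap X" "prod.swap f"] assms
    by (auto simp: dual_iso.Obj_iff dual_iso.Hom_iff)
  then have "is_cokernel A X Y f (opposite_bimap K) (prod.swap k)"
    by (subst dual_iso.is_kernel_iff[symmetric]) simp
  then show ?thesis by blast
qed

lemma Adj_mono_is_kernel:
  assumes "X \<in> Obj A" "Y \<in> Obj A" "is_mono A X Y f"
  shows "\<exists>Z \<in> Obj A. \<exists>g \<in> Hom A Y Z. is_kernel A Y Z g X f"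
proof -
  have "\<exists>Z \<in> Obj dual.A. \<exists>g \<in> Hom dual.A Z (opposite_bimap Y).
      is_cokernel dual.A Z (opposite_bimap Y) g (opposite_bimap X) (prod.swap f)"
    using assms by (intro dual.Adj_epi_is_cokernel) (simp_all add: dual_iso.Obj_iff dual_iso.is_epi_iff)
  then obtain Z g where "opposite_bimap Z \<in> Obj dual.A"
    "prod.swap g \<in> Hom dual.A (opposite_bimap Z) (opposite_bimap Y)"
    "is_cokernel dual.A (opposite_bimap Z) (opposite_bimap Y) (prod.swap g) (opposite_bimap X) (prod.swap f)"
    using dual_iso.FG dual_iso.\<phi>\<psi> by metis
  then show ?thesis
    by (auto simp: dual_iso.Obj_iff dual_iso.Hom_iff dual_iso.is_cokernel_iff)
qed

lemma Adj_colimits: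
  fixes J :: "('i, 'j) category"
  assumes J: "small_index \<U> (Obj J)" and F: "is_functor J A F\<^sub>0 F\<^sub>1"
  shows "\<exists>X \<iota>. is_colimit J A F\<^sub>0 F\<^sub>1 X \<iota>"
proof -
  have "small_index \<U> (Obj (opposite_category J))" using J by (simp add: opposite_category_def)
  from dual.Adj_limits[OF this dual_iso.is_functor_opposite[OF F]]
  show ?thesis using dual_iso.is_colimit_if_limit by blast
qed

lemma Adj_abelian: "abelian_category A"
  by unfold_locales
    (rule Adj_zero_object, (rule Adj_biproducts Adj_kernels Adj_cokernels Adj_mono_is_kernel Adj_epi_is_cokernel; assumption)+)

end

theorem theorem2p27:
  fixes R :: "('r, 'p) ring_scheme"
    and S :: "('s, 'q) ring_scheme"
    and W :: "('r, 's, 'w) bimodule"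
    and \<U> :: "'m set set"
  assumes "ring R" and "ring S" and "is_bimodule R S W" and "set_universe \<U>"
  shows "abelian_category (Adj \<U> R S W)
    \<and> complete_category (small_category \<U> :: ('i, 'j) category \<Rightarrow> bool) (Adj \<U> R S W)
    \<and> cocomplete_category (small_category \<U> :: ('i, 'j) category \<Rightarrow> bool) (Adj \<U> R S W)"
proof -
  interpret adjoint_category R S W \<U>
    using assms(3,4) by unfold_locales
  show ?thesis
    using Adj_abelian Adj_limits Adj_colimits
    by (auto simp: complete_category_def cocomplete_category_def small_category_def)
qed

end
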